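(* Fix a prime power $q$ and $n\ge1$. Suppose that for every composition $\alpha$ of $n$ and every integer $m\ge 0$ one has $$\mathrm{Hilb}\bigl((S/\mathfrak{m}^{[q^m]})^{P_\alpha},t\bigr)=C_{\alpha,m}(t).$$ Then for every composition $\alpha=(\alpha_1,\dots,\alpha_\ell)$ of $n$ the $P_\alpha$-cofixed space $S_{P_\alpha}$ has Hilbert series $$\mathrm{Hilb}(S_{P_\alpha},t)=\sum_{\beta:\ \beta\le\alpha} t^{\sum_{i=1}^\ell\alpha_i(q^{B_i}-1)}\prod_{i=1}^\ell\prod_{j=0}^{\beta_i-1}\frac{1}{1-t^{q^{B_i}-q^{B_{i-1}+j}}}.$$
   Context: $S=\mathbb{F}_q[x_1,\dots,x_n]$ with the standard grading; $g=(g_{ij})\in GL_n(\mathbb{F}_q)$ acts on $S$ by $\mathbb{F}_q$-algebra automorphisms with $g(x_j)=\sum_i g_{ij}x_i$. $\mathfrak{m}^{[q^m]}=(x_1^{q^m},\dots,x_n^{q^m})$, a $GL_n(\mathbb{F}_q)$-stable ideal. A composition $\alpha=(\alpha_1,\dots,\alpha_\ell)$ of $n$ has positive integer parts summing to $n$; $P_\alpha\subset GL_n(\mathbb{F}_q)$ is the subgroup of block upper-triangular invertible matrices with diagonal blocks of sizes $\alpha_1,\dots,\alpha_\ell$. A superscript $P_\alpha$ denotes the fixed subspace. The cofixed space $S_{P_\alpha}$ is $S/N$, where $N$ is the $\mathbb{F}_q$-span of all $g(f)-f$, $g\in P_\alpha$, $f\in S$. For a graded vector space $U$, $\mathrm{Hilb}(U,t)=\sum_d\dim_{\mathbb{F}_q}(U_d)t^d$.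 Sums over $\beta$ run over weak compositions $\beta=(\beta_1,\dots,\beta_\ell)$ (nonnegative integers) with $\beta_i\le\alpha_i$ for all $i$; $|\beta|=\sum\beta_i$, $B_i=\beta_1+\cdots+\beta_i$, $B_0=0$. Empty products are $1$. Finally $$C_{\alpha,m}(t)=\sum_{\substack{\beta\le\alpha\\|\beta|\le m}}t^{\sum_{i=1}^\ell(\alpha_i-\beta_i)(q^m-q^{B_i})}\ \frac{\prod_{j=0}^{|\beta|-1}(1-t^{q^m-q^j})}{\prod_{i=1}^{\ell}\prod_{j=0}^{\beta_i-1}\bigl(1-t^{q^{B_i}-q^{B_{i-1}+j}}\bigr)}.$$ *)

theory Defs
  imports
    "HOL-Analysis.Analysis"
    "HOL-Library.Poly_Mapping"
    "HOL-Library.Set_Algebras"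
    "HOL-Computational_Algebra.Formal_Power_Series"
begin

section \<open>The polynomial ring\<close>

text \<open>
  The variables are indexed by a finite linearly ordered type \<open>'n\<close>, so that \<open>n = CARD('n)\<close>;
  the order is only needed to speak about block upper-triangular matrices.
\<close>

type_synonym ('n, 'k) mpoly = "('n \<Rightarrow>\<^sub>0 nat) \<Rightarrow>\<^sub>0 'k"

definition mconst :: "'k::comm_ring_1 \<Rightarrow> ('n, 'k) mpoly" where
  "mconst c = Poly_Mapping.single 0 c"

definition mvar :: "'n \<Rightarrow> ('n, 'k::comm_ring_1) mpoly" where
  "mvar i = Poly_Mapping.single (Poly_Mapping.single i 1) 1"

definition mscale :: "'k::comm_ring_1 \<Rightarrow> ('n, 'k) mpoly \<Rightarrow> ('n, 'k) mpoly" where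
  "mscale c f = mconst c * f"

interpretation mpoly_vs: vector_space "mscale :: 'k::field \<Rightarrow> ('n, 'k) mpoly \<Rightarrow> ('n, 'k) mpoly"
  by unfold_locales
    (simp_all add: mscale_def mconst_def distrib_left distrib_right single_add mult_single
       flip: mult.assoc)

text \<open>The subspaces of a ring as a module over itself are its ideals.\<close>

interpretation mpoly_ideal:
  module "(*) :: ('n, 'k::comm_ring_1) mpoly \<Rightarrow> ('n, 'k) mpoly \<Rightarrow> ('n, 'k) mpoly"
  by unfold_locales (simp_all add: algebra_simps)

definition homogeneous_part :: "nat \<Rightarrow> ('n::finite, 'k::comm_ring_1) mpoly set" where
  "homogeneous_part d =
     {f. \<forall>e \<in> Poly_Mapping.keys f. (\<Sum>i\<in>UNIV. Poly_Mapping.lookup e i) = d}"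

text \<open>The ideal generated by the powers \<open>x\<^sub>i\<^bsup>r\<^esup>\<close>.\<close>

definition frobenius_power :: "nat \<Rightarrow> ('n, 'k::comm_ring_1) mpoly set" where
  "frobenius_power r = mpoly_ideal.span (range (\<lambda>i. mvar i ^ r))"


section \<open>The parabolic subgroups and their action\<close>

definition subst_act ::
  "'k::comm_ring_1 ^ 'n::finite ^ 'n::finite \<Rightarrow> ('n::finite, 'k) mpoly \<Rightarrow> ('n, 'k) mpoly" where
  "subst_act g f =
     (\<Sum>e \<in> Poly_Mapping.keys f. mconst (Poly_Mapping.lookup f e) *
        (\<Prod>j\<in>UNIV. (\<Sum>i\<in>UNIV. mconst (g $ i $ j) * mvar i) ^ Poly_Mapping.lookup e j))"

definition composition :: "nat list \<Rightarrow> nat \<Rightarrow> bool" where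
  "composition \<alpha> n \<longleftrightarrow> (\<forall>a \<in> set \<alpha>. 0 < a) \<and> sum_list \<alpha> = n"

text \<open>
  The number (from \<open>0\<close>) of the block of \<open>\<alpha>\<close> that contains \<open>i\<close>, where
  \<open>card {j. j < i}\<close> is the position (from \<open>0\<close>) of \<open>i\<close> in \<open>'n\<close>.
\<close>

definition block :: "nat list \<Rightarrow> 'n::{finite, linorder} \<Rightarrow> nat" where
  "block \<alpha> i = (LEAST k. card {j. j < i} < sum_list (take (Suc k) \<alpha>))"

definition parabolic :: "nat list \<Rightarrow> ('k::field ^ 'n::{finite, linorder} ^ 'n::{finite, linorder}) set" where
  "parabolic \<alpha> = {g. invertible g \<and> (\<forall>i j. block \<alpha> j < block \<alpha> i \<longrightarrow> g $ i $ j = 0)}"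


section \<open>Quotient spaces and Hilbert series\<close>

text \<open>
  A quotient of the polynomial ring by a subspace \<open>W\<close> is the set of cosets \<open>f +o W\<close>.
\<close>

definition quotient_space :: "('n, 'k::field) mpoly set \<Rightarrow> ('n, 'k) mpoly set set" where
  "quotient_space W = range (\<lambda>f. f +o W)"

text \<open>
  The linear combination of the cosets in \<open>B\<close> with coefficients \<open>c\<close>. Addition is that of
  \<^theory>\<open>HOL-Library.Set_Algebras\<close>, which on cosets of \<open>W\<close> is addition in the quotient.
  The summand \<open>W\<close> is the zero of the quotient; it is needed since multiplying a coset
  elementwise by the scalar \<open>0\<close> gives \<open>{0}\<close>, and since the empty sum of sets is \<open>{0}\<close>.
\<close>

definition coset_lincomb ::
  "('n, 'k::field) mpoly set \<Rightarrow> (('n, 'k) mpoly set \<Rightarrow> 'k) \<Rightarrow> ('n, 'k) mpoly set set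
     \<Rightarrow> ('n, 'k) mpoly set" where
  "coset_lincomb W c B = W + (\<Sum>A\<in>B. mscale (c A) ` A)"

lemma coset_lincomb_eq:
  assumes W: "mpoly_vs.subspace W" and "finite B" and r: "\<And>A. A \<in> B \<Longrightarrow> A = r A +o W"
  shows "coset_lincomb W c B = (\<Sum>A\<in>B. mscale (c A) (r A)) +o W"
  using assms(2) r
proof (induction B rule: finite_induct)
  case empty
  then show ?case by (simp add: coset_lincomb_def elt_set_plus_def)
next
  case (insert A B)
  let ?s = "\<Sum>A\<in>B. mscale (c A) (r A)"
  have mem: "x \<in> A \<longleftrightarrow> (\<exists>w\<in>W. x = r A + w)" for x
    using insert.prems[of A] by (auto simp: elt_set_plus_def)
  have IH: "W + (\<Sum>A\<in>B. mscale (c A) ` A) = ?s +o W"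
    using insert.IH insert.prems by (auto simp only: coset_lincomb_def insert_iff)
  have "coset_lincomb W c (insert A B) = mscale (c A) ` A + (W + (\<Sum>A\<in>B. mscale (c A) ` A))"
    using insert.hyps by (simp add: coset_lincomb_def add.left_commute)
  also have "\<dots> = mscale (c A) ` A + (?s +o W)"
    by (simp only: IH)
  also have "\<dots> = (mscale (c A) (r A) + ?s) +o W"
  proof (intro subset_antisym subsetI)
    fix x assume "x \<in> mscale (c A) ` A + (?s +o W)"
    then obtain a b where ab: "a \<in> A" "b \<in> ?s +o W" "x = mscale (c A) a + b"
      by (elim set_plus_elim imageE) metis
    obtain w where w: "w \<in> W" "a = r A + w" using mem ab(1) by metis
    obtain v where v: "v \<in> W" "b = ?s + v" using ab(2) unfolding elt_set_plus_def by auto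
    have wv: "w \<in> W" "v \<in> W" "x = mscale (c A) (r A + w) + (?s + v)"
      using ab w v by simp_all
    have 1: "mscale (c A) w + v \<in> W"
      using W wv by (simp add: mpoly_vs.subspace_add mpoly_vs.subspace_scale)
    have 2: "x = (mscale (c A) (r A) + ?s) + (mscale (c A) w + v)"
      using wv(3) by (simp add: mpoly_vs.scale_right_distrib ac_simps)
    show "x \<in> (mscale (c A) (r A) + ?s) +o W"
      unfolding 2 by (rule set_plus_intro2[OF 1])
  next
    fix x assume "x \<in> (mscale (c A) (r A) + ?s) +o W"
    then obtain w where w: "w \<in> W" "x = mscale (c A) (r A) + (?s + w)"
      unfolding elt_set_plus_def by (auto simp only: add.assoc mem_Collect_eq)
    have "r A \<in> A"
      using mem mpoly_vs.subspace_0[OF W] by (metis add.right_neutral)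
    then show "x \<in> mscale (c A) ` A + (?s +o W)"
      unfolding w(2) by (intro set_plus_intro imageI set_plus_intro2 w(1))
  qed
  finally show ?case using insert.hyps by simp
qed

definition coset_basis ::
  "('n, 'k::field) mpoly set \<Rightarrow> ('n, 'k) mpoly set set \<Rightarrow> ('n, 'k) mpoly set set \<Rightarrow> bool" where
  "coset_basis W U B \<longleftrightarrow> finite B \<and> B \<subseteq> U \<and>
     (\<forall>A\<in>U. \<exists>!c. (\<forall>C. C \<notin> B \<longrightarrow> c C = 0) \<and> A = coset_lincomb W c B)"

text \<open>Meaningful for finite-dimensional subspaces \<open>U\<close> of the quotient by \<open>W\<close> only.\<close>

definition coset_dim :: "('n, 'k::field) mpoly set \<Rightarrow> ('n, 'k) mpoly set set \<Rightarrow> nat" where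
  "coset_dim W U = card (SOME B. coset_basis W U B)"

text \<open>
  The Hilbert series of a graded subspace \<open>U\<close> of the quotient by a homogeneous subspace \<open>W\<close>;
  the degree \<open>d\<close> part of the quotient consists of the cosets of the forms of degree \<open>d\<close>.
\<close>

definition hilbert_series ::
  "('n::finite, 'k::field) mpoly set \<Rightarrow> ('n, 'k) mpoly set set \<Rightarrow> rat fps" where
  "hilbert_series W U =
     Abs_fps (\<lambda>d. of_nat (coset_dim W (U \<inter> (\<lambda>f. f +o W) ` homogeneous_part d)))"

text \<open>
  For \<open>W\<close> stable under \<open>G\<close>, an element \<open>g\<close> of \<open>G\<close> maps the coset \<open>A\<close> to its image
  \<open>subst_act g ` A\<close>.
\<close>

definition fixed_space ::
  "('k::field ^ 'n::finite ^ 'n::finite) set \<Rightarrow> ('n::finite, 'k) mpoly set \<Rightarrow> ('n, 'k) mpoly set set" where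
  "fixed_space G W = {A \<in> quotient_space W. \<forall>g\<in>G. subst_act g ` A = A}"

text \<open>The cofixed space of \<open>G\<close> is the quotient by the following subspace.\<close>

definition cofixed_kernel :: "('k::field ^ 'n::finite ^ 'n::finite) set \<Rightarrow> ('n::finite, 'k) mpoly set" where
  "cofixed_kernel G = mpoly_vs.span {subst_act g f - f | g f. g \<in> G}"


section \<open>The series\<close>

definition weak_compositions_below :: "nat list \<Rightarrow> nat list set" where
  "weak_compositions_below \<alpha> = {\<beta>. length \<beta> = length \<alpha> \<and> (\<forall>i<length \<alpha>. \<beta> ! i \<le> \<alpha> ! i)}"

text \<open>
  Lists are indexed from \<open>0\<close>, so \<open>\<alpha> ! i\<close> and \<open>\<beta> ! i\<close> are the mathematical
  \<open>\<alpha>\<^bsub>i+1\<^esub>\<close> and \<open>\<beta>\<^bsub>i+1\<^esub>\<close>, while \<open>psum \<beta> i\<close> is the mathematical \<open>B\<^sub>i\<close>.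
\<close>

definition psum :: "nat list \<Rightarrow> nat \<Rightarrow> nat" where
  "psum \<beta> i = sum_list (take i \<beta>)"

definition qt_denominator :: "nat \<Rightarrow> nat list \<Rightarrow> rat fps" where
  "qt_denominator q \<beta> =
     (\<Prod>i<length \<beta>. \<Prod>j<\<beta> ! i. 1 - fps_X ^ (q ^ psum \<beta> (Suc i) - q ^ (psum \<beta> i + j)))"

definition C_series :: "nat \<Rightarrow> nat list \<Rightarrow> nat \<Rightarrow> rat fps" where
  "C_series q \<alpha> m =
     (\<Sum>\<beta> \<in> {\<beta> \<in> weak_compositions_below \<alpha>. sum_list \<beta> \<le> m}.
        fps_X ^ (\<Sum>i<length \<alpha>. (\<alpha> ! i - \<beta> ! i) * (q ^ m - q ^ psum \<beta> (Suc i))) *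
        ((\<Prod>j<sum_list \<beta>. 1 - fps_X ^ (q ^ m - q ^ j)) / qt_denominator q \<beta>))"

definition cofixed_series :: "nat \<Rightarrow> nat list \<Rightarrow> rat fps" where
  "cofixed_series q \<alpha> =
     (\<Sum>\<beta> \<in> weak_compositions_below \<alpha>.
        fps_X ^ (\<Sum>i<length \<alpha>. \<alpha> ! i * (q ^ psum \<beta> (Suc i) - 1)) *
        (\<Prod>i<length \<alpha>. \<Prod>j<\<beta> ! i.
           1 / (1 - fps_X ^ (q ^ psum \<beta> (Suc i) - q ^ (psum \<beta> i + j)))))"

end

theory Submission
  imports Defs "HOL-Computational_Algebra.Polynomial_FPS"
begin

text \<open>
  Put \<open>r = q\<^sup>m\<close> and let \<open>\<tau> f\<close> be the coefficient of \<open>x\<^sub>1\<^bsup>r-1\<^esup> \<cdots> x\<^sub>n\<^bsup>r-1\<^esup>\<close> in \<open>f\<close>. The quotient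
  by the Frobenius power is a Gorenstein ring with socle in degree \<open>D = n (r - 1)\<close>, so that
  \<open>\<tau> (f h)\<close> pairs its degree \<open>D - d\<close> part perfectly with its degree \<open>d\<close> part, which for \<open>d < r\<close>
  is that of the polynomial ring. Since \<open>det g\<^bsup>r-1\<^esup> = 1\<close>, \<open>\<tau>\<close> is invariant under the general linear
  group; hence the fixed part in degree \<open>D - d\<close> is the annihilator of the cofixed kernel in degree \<open>d\<close>,
  and its dimension is that of the cofixed space in degree \<open>d\<close>. The cofixed series is thus the
  coefficientwise limit of \<open>t\<^sup>D C\<^bsub>\<alpha>,m\<^esub>(1/t)\<close> for \<open>m \<rightarrow> \<infinity>\<close>.
\<close>

text \<open>\<open>coset_dim\<close> is the size of a chosen basis of cosets, so dimensions are
  compared by counting: over a field with q elements a space of dimension k has q^k elements, every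
  graded piece is finite, and duality becomes the equality of two cardinalities. On the side of the
  series the obstacle is that t^D C(1/t) is a power series only if C is a polynomial of degree at
  most D, which the formula for C does not show. The hypothesis supplies it: C is the Hilbert series
  of a space that vanishes above the socle degree. Each summand of C is then reflected as a rational
  function. Its numerator and denominator have |\<beta>| factors each, so the signs cancel, and the
  numerator factors 1 - t^(q^m - q^j) do not reach degree d once m is large. For fixed d the limit
  is therefore attained at a finite m.\<close>

text \<open>As a rewrite rule this instance is \<open>a * (b * x) = a * b * x\<close>, which loops with \<open>mult.assoc\<close>.\<close>

declare mpoly_ideal.scale_scale [simp del]

section \<open>Polynomials as sums of terms\<close>

lemma poly_mapping_sum_single:
  "(\<Sum>e\<in>Poly_Mapping.keys f. Poly_Mapping.single e (Poly_Mapping.lookup f e)) = f"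
  by (rule poly_mapping_eqI)
    (auto simp: lookup_sum lookup_single when_def in_keys_iff sum.delta' cong: if_cong)

text \<open>For an additive claim it suffices to treat terms: 0 is itself a term with coefficient 0,
  so no separate base case is asked for.\<close>

lemma poly_mapping_induct [case_names single add]:
  fixes f :: "'a \<Rightarrow>\<^sub>0 'b::comm_monoid_add"
  assumes single: "\<And>e c. P (Poly_Mapping.single e c)"
    and add: "\<And>f g. P f \<Longrightarrow> P g \<Longrightarrow> P (f + g)"
  shows "P f"
proof -
  have "P (\<Sum>e\<in>A. Poly_Mapping.single e (Poly_Mapping.lookup f e))" if "finite A" for A
    using that
  proof induction
    case empty
    show ?case using single[of undefined 0] by simp
  next
    case (insert x F)
    then show ?case by (simp add: assms)
  qed
  from this[of "Poly_Mapping.keys f"] show ?thesis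
    by (simp add: poly_mapping_sum_single)
qed

lemma mconst_simps:
  "mconst 0 = 0" "mconst 1 = 1" "mconst (a + b) = mconst a + mconst b"
  "mconst (a * b) = mconst a * mconst b" "mconst (- a) = - mconst a"
  by (simp_all add: mconst_def single_add mult_single single_uminus)

lemma mconst_power: "mconst (a ^ k) = mconst a ^ k"
  by (induction k) (simp_all add: mconst_simps)

lemma mconst_sum: "mconst (\<Sum>i\<in>I. f i) = (\<Sum>i\<in>I. mconst (f i))"
  by (induction I rule: infinite_finite_induct) (simp_all add: mconst_simps)

lemma mconst_of_nat: "mconst (of_nat k) = of_nat k"
  by (induction k) (simp_all add: mconst_simps)

lemma lookup_mconst_mult:
  "Poly_Mapping.lookup (mconst c * f) e = c * Poly_Mapping.lookup f e"
proof (induction f rule: poly_mapping_induct)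
  case (single e' c')
  show ?case by (simp add: mconst_def mult_single lookup_single when_def)
next
  case (add f g)
  then show ?case by (simp add: distrib_left lookup_add)
qed

lemma mvar_power:
  "mvar i ^ k = (Poly_Mapping.single (Poly_Mapping.single i k) 1 :: ('n, 'k::comm_ring_1) mpoly)"
  by (induction k) (simp_all add: mvar_def mult_single flip: single_add)

section \<open>Substitution\<close>

text \<open>For \<open>w\<close> a column of \<open>g\<close> this is the image of a variable under
  \<open>g\<close>.\<close>

definition linform :: "('n \<Rightarrow> 'k) \<Rightarrow> ('n::finite, 'k::comm_ring_1) mpoly" where
  "linform w = (\<Sum>i\<in>UNIV. mconst (w i) * mvar i)"

lemma linform_add: "linform (\<lambda>i. v i + w i) = linform v + linform w"
  by (simp add: linform_def mconst_simps distrib_right sum.distrib)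

lemma linform_scale: "linform (\<lambda>i. c * w i) = mconst c * linform w"
  unfolding linform_def sum_distrib_left by (simp add: mconst_simps(4) mult.assoc)

lemma linform_delta: "linform (\<lambda>i. if i = j then 1 else 0) = mvar j"
proof -
  have "linform (\<lambda>i. if i = j then 1 else 0) = (\<Sum>i\<in>UNIV. if i = j then mvar i else 0)"
    unfolding linform_def by (intro sum.cong) (auto simp: mconst_simps)
  then show ?thesis by simp
qed

text \<open>\<open>subst_act\<close> sums over the support, which changes under addition. A common
  larger index set makes additivity visible; the extra terms have coefficient 0.\<close>

lemma subst_act_superset:
  assumes "finite A" "Poly_Mapping.keys f \<subseteq> A"
  shows "subst_act g f = (\<Sum>e\<in>A. mconst (Poly_Mapping.lookup f e) *
      (\<Prod>j\<in>UNIV. linform (\<lambda>i. g $ i $ j) ^ Poly_Mapping.lookup e j))"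
  unfolding subst_act_def linform_def
  by (rule sum.mono_neutral_left) (use assms in \<open>auto simp: in_keys_iff mconst_simps\<close>)

lemma subst_act_single:
  "subst_act g (Poly_Mapping.single e c) =
     mconst c * (\<Prod>j\<in>UNIV. linform (\<lambda>i. g $ i $ j) ^ Poly_Mapping.lookup e j)"
  by (subst subst_act_superset[of "{e}"]) (auto simp: lookup_single)

lemma subst_act_add: "subst_act g (f + h) = subst_act g f + subst_act g h"
  by (subst (1 2 3) subst_act_superset[of "Poly_Mapping.keys f \<union> Poly_Mapping.keys h"])
    (use keys_add[of f h] in
      \<open>auto simp: lookup_add mconst_simps distrib_right sum.distrib\<close>)

lemma subst_act_0: "subst_act g 0 = 0"
  by (simp add: subst_act_def)

lemma subst_act_uminus: "subst_act g (- f) = - subst_act g f"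
  using subst_act_add[of g f "- f"] by (simp add: subst_act_0 eq_neg_iff_add_eq_0 add.commute)

lemma subst_act_diff: "subst_act g (f - h) = subst_act g f - subst_act g h"
  using subst_act_add[of g f "- h"] by (simp add: subst_act_uminus)

lemma subst_act_mult: "subst_act g (f * h) = subst_act g f * subst_act g h"
proof (induction f rule: poly_mapping_induct)
  case (single e c)
  show ?case
  proof (induction h rule: poly_mapping_induct)
    case (single e' c')
    show ?case
      by (simp add: mult_single subst_act_single mconst_simps lookup_add power_add prod.distrib ac_simps)
  next
    case (add f g)
    then show ?case by (simp add: distrib_left subst_act_add)
  qed
next
  case (add f g)
  then show ?case by (simp add: distrib_right subst_act_add)
qed

lemma subst_act_mconst: "subst_act g (mconst c) = mconst c"
  by (simp add: mconst_def subst_act_single)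

lemma subst_act_1: "subst_act g 1 = 1"
  using subst_act_mconst[of g 1] by (simp add: mconst_simps)

lemma subst_act_mvar: "subst_act g (mvar j) = linform (\<lambda>i. g $ i $ j)"
proof -
  have "(\<Prod>k\<in>UNIV. linform (\<lambda>i. g $ i $ k) ^ Poly_Mapping.lookup (Poly_Mapping.single j 1) k) =
      (\<Prod>k\<in>UNIV. if k = j then linform (\<lambda>i. g $ i $ k) else 1)"
    by (intro prod.cong) (auto simp: lookup_single)
  then show ?thesis
    by (simp add: mvar_def subst_act_single mconst_simps)
qed

lemma subst_act_power: "subst_act g (f ^ k) = subst_act g f ^ k"
  by (induction k) (simp_all add: subst_act_1 subst_act_mult)

lemma subst_act_sum: "subst_act g (\<Sum>i\<in>I. f i) = (\<Sum>i\<in>I. subst_act g (f i))"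
  by (induction I rule: infinite_finite_induct) (simp_all add: subst_act_0 subst_act_add)

lemma subst_act_prod: "subst_act g (\<Prod>i\<in>I. f i) = (\<Prod>i\<in>I. subst_act g (f i))"
  by (induction I rule: infinite_finite_induct) (simp_all add: subst_act_1 subst_act_mult)

lemma subst_act_mscale: "subst_act g (mscale c f) = mscale c (subst_act g f)"
  by (simp add: mscale_def subst_act_mult subst_act_mconst)

lemma subst_act_linform: "subst_act g (linform w) = linform (\<lambda>i. \<Sum>k\<in>UNIV. g $ i $ k * w k)"
proof -
  have "subst_act g (linform w) = (\<Sum>k\<in>UNIV. \<Sum>i\<in>UNIV. mconst (g $ i $ k * w k) * mvar i)"
    unfolding linform_def
    by (simp add: subst_act_sum subst_act_mult subst_act_mconst subst_act_mvar linform_def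
        sum_distrib_left mconst_simps mult.assoc mult.left_commute)
  also have "\<dots> = (\<Sum>i\<in>UNIV. \<Sum>k\<in>UNIV. mconst (g $ i $ k * w k) * mvar i)"
    by (rule sum.swap)
  finally show ?thesis
    by (simp add: linform_def mconst_sum sum_distrib_right)
qed

lemma subst_act_matrix_mult: "subst_act (g ** h) f = subst_act g (subst_act h f)"
proof (induction f rule: poly_mapping_induct)
  case (single e c)
  show ?case
    by (simp add: subst_act_single subst_act_mult subst_act_mconst subst_act_prod subst_act_power
        subst_act_linform) (simp add: matrix_matrix_mult_def)
next
  case (add f g)
  then show ?case by (simp add: subst_act_add)
qed

lemma single_eq_monomial:
  fixes e :: "'n::finite \<Rightarrow>\<^sub>0 nat" and c :: "'k::comm_ring_1"
  shows "Poly_Mapping.single e c = mconst c * (\<Prod>j\<in>UNIV. mvar j ^ Poly_Mapping.lookup e j)"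
proof -
  have *: "(\<Prod>j\<in>A. Poly_Mapping.single (Poly_Mapping.single j (Poly_Mapping.lookup e j)) 1) =
     Poly_Mapping.single (\<Sum>j\<in>A. Poly_Mapping.single j (Poly_Mapping.lookup e j)) (1::'k)" for A
    by (induction A rule: infinite_finite_induct) (simp_all add: mult_single)
  have "(\<Sum>j\<in>UNIV. Poly_Mapping.single j (Poly_Mapping.lookup e j)) = e"
    by (rule poly_mapping_eqI)
      (auto simp: lookup_sum lookup_single when_def)
  then show ?thesis
    by (simp add: mvar_power * mconst_def mult_single)
qed

lemma subst_act_mat_1:
  fixes f :: "('a::finite, 'b::comm_ring_1) mpoly"
  shows "subst_act (mat 1) f = f"
proof (induction f rule: poly_mapping_induct)
  case (single e c)
  have "linform (\<lambda>i. (mat 1 :: 'b ^ 'a ^ 'a) $ i $ j) = mvar j" for j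
    using linform_delta[of j] by (simp add: mat_def)
  then show ?case
    unfolding subst_act_single by (simp add: single_eq_monomial)
next
  case (add f g)
  then show ?case by (simp add: subst_act_add)
qed

section \<open>Homogeneous polynomials\<close>

lemma homogeneous_0: "0 \<in> homogeneous_part d"
  and homogeneous_add: "f \<in> homogeneous_part d \<Longrightarrow> h \<in> homogeneous_part d \<Longrightarrow> f + h \<in> homogeneous_part d"
  and homogeneous_uminus: "f \<in> homogeneous_part d \<Longrightarrow> - f \<in> homogeneous_part d"
  and homogeneous_single: "c = 0 \<or> (\<Sum>i\<in>UNIV. Poly_Mapping.lookup e i) = d \<Longrightarrow>
     Poly_Mapping.single e c \<in> homogeneous_part d"
  using keys_add[of f h] by (auto simp: homogeneous_part_def in_keys_iff split: if_splits)

lemma homogeneous_diff: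
  "f \<in> homogeneous_part d \<Longrightarrow> h \<in> homogeneous_part d \<Longrightarrow> f - h \<in> homogeneous_part d"
  using homogeneous_add[of f d "- h"] homogeneous_uminus by fastforce

lemma homogeneous_sum:
  "(\<And>i. i \<in> I \<Longrightarrow> f i \<in> homogeneous_part d) \<Longrightarrow> (\<Sum>i\<in>I. f i) \<in> homogeneous_part d"
  by (induction I rule: infinite_finite_induct) (auto intro: homogeneous_0 homogeneous_add)

lemma homogeneous_mult:
  assumes "f \<in> homogeneous_part a" "h \<in> homogeneous_part b"
  shows "f * h \<in> homogeneous_part (a + b)"
  using assms keys_mult[of f h]
  by (fastforce simp: homogeneous_part_def lookup_add sum.distrib)

lemma homogeneous_mconst: "mconst c \<in> homogeneous_part 0"
  by (simp add: mconst_def homogeneous_single)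

lemma homogeneous_mvar: "mvar i \<in> homogeneous_part 1"
  unfolding mvar_def by (rule homogeneous_single) (simp add: lookup_single when_def)

lemma homogeneous_mscale: "f \<in> homogeneous_part d \<Longrightarrow> mscale c f \<in> homogeneous_part d"
  using homogeneous_mult[OF homogeneous_mconst] by (fastforce simp: mscale_def)

lemma homogeneous_linform: "linform w \<in> homogeneous_part 1"
  unfolding linform_def
  using homogeneous_mult[OF homogeneous_mconst homogeneous_mvar] by (auto intro!: homogeneous_sum)

lemma homogeneous_power: "f \<in> homogeneous_part d \<Longrightarrow> f ^ k \<in> homogeneous_part (k * d)"
proof (induction k)
  case 0
  then show ?case using homogeneous_mconst[of 1] by (simp add: mconst_simps)
qed (auto intro: homogeneous_mult)

lemma homogeneous_prod:
  "(\<And>i. i \<in> I \<Longrightarrow> f i \<in> homogeneous_part (d i)) \<Longrightarrow> (\<Prod>i\<in>I. f i) \<in> homogeneous_part (\<Sum>i\<in>I. d i)"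
proof (induction I rule: infinite_finite_induct)
  case (infinite A)
  then show ?case using homogeneous_mconst[of 1] by (simp add: mconst_simps)
next
  case empty
  then show ?case using homogeneous_mconst[of 1] by (simp add: mconst_simps)
qed (auto intro: homogeneous_mult)

lemma homogeneous_subst_act:
  assumes "f \<in> homogeneous_part d"
  shows "subst_act g f \<in> homogeneous_part d"
  unfolding subst_act_def linform_def[symmetric]
proof (rule homogeneous_sum)
  fix e assume e: "e \<in> Poly_Mapping.keys f"
  have "(\<Prod>j\<in>UNIV. linform (\<lambda>i. g $ i $ j) ^ Poly_Mapping.lookup e j)
     \<in> homogeneous_part (\<Sum>j\<in>UNIV. Poly_Mapping.lookup e j * 1)"
    by (intro homogeneous_prod homogeneous_power homogeneous_linform)
  moreover have "(\<Sum>j\<in>UNIV. Poly_Mapping.lookup e j * 1) = d"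
    using assms e by (simp add: homogeneous_part_def)
  ultimately show "mconst (Poly_Mapping.lookup f e) *
      (\<Prod>j\<in>UNIV. linform (\<lambda>i. g $ i $ j) ^ Poly_Mapping.lookup e j) \<in> homogeneous_part d"
    using homogeneous_mult[OF homogeneous_mconst] by fastforce
qed

lemma finite_exponents: "finite {e :: 'n::finite \<Rightarrow>\<^sub>0 nat. (\<Sum>i\<in>UNIV. Poly_Mapping.lookup e i) = d}"
proof (rule inj_on_finite[where f = Poly_Mapping.lookup])
  show "Poly_Mapping.lookup ` {e :: 'n \<Rightarrow>\<^sub>0 nat. (\<Sum>i\<in>UNIV. Poly_Mapping.lookup e i) = d}
     \<subseteq> PiE UNIV (\<lambda>_. {..d})"
  proof (clarsimp simp: PiE_UNIV_domain)
    fix e :: "'n \<Rightarrow>\<^sub>0 nat" and i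
    show "Poly_Mapping.lookup e i \<le> sum (Poly_Mapping.lookup e) UNIV"
      by (rule member_le_sum) auto
  qed
  show "finite (PiE (UNIV :: 'n set) (\<lambda>_. {..d}))" by (intro finite_PiE) auto
  show "inj_on Poly_Mapping.lookup {e :: 'n \<Rightarrow>\<^sub>0 nat. (\<Sum>i\<in>UNIV. Poly_Mapping.lookup e i) = d}"
    by (rule inj_onI) (rule poly_mapping_eq_iff[THEN iffD2])
qed

text \<open>A form is determined by its coefficients at the finitely many exponents of its degree.
  With a finite coefficient ring this gives the finiteness that later lets dimensions be found by
  counting.\<close>

lemma finite_homogeneous_part: "finite (homogeneous_part d :: ('n::finite, 'k::{finite, comm_ring_1}) mpoly set)"
proof (rule inj_on_finite[where f = "\<lambda>f. restrict (Poly_Mapping.lookup f)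
      {e :: 'n \<Rightarrow>\<^sub>0 nat. (\<Sum>i\<in>UNIV. Poly_Mapping.lookup e i) = d}"])
  let ?E = "{e :: 'n \<Rightarrow>\<^sub>0 nat. (\<Sum>i\<in>UNIV. Poly_Mapping.lookup e i) = d}"
  show "finite (PiE ?E (\<lambda>_. UNIV :: 'k set))"
    by (intro finite_PiE finite_exponents) auto
  show "inj_on (\<lambda>f. restrict (Poly_Mapping.lookup f) ?E) (homogeneous_part d :: ('n, 'k) mpoly set)"
  proof (rule inj_onI, rule poly_mapping_eqI)
    fix f h :: "('n, 'k) mpoly" and e
    assume *: "f \<in> homogeneous_part d" "h \<in> homogeneous_part d"
      "restrict (Poly_Mapping.lookup f) ?E = restrict (Poly_Mapping.lookup h) ?E"
    then show "Poly_Mapping.lookup f e = Poly_Mapping.lookup h e"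
    proof (cases "e \<in> ?E")
      case True
      then show ?thesis
        using fun_cong[OF *(3), of e] by (simp only: restrict_apply if_True)
    next
      case False
      then have "e \<notin> Poly_Mapping.keys f" "e \<notin> Poly_Mapping.keys h"
        using *(1,2) by (auto simp only: homogeneous_part_def mem_Collect_eq)
      then show ?thesis by (simp add: in_keys_iff)
    qed
  qed
  show "(\<lambda>f. restrict (Poly_Mapping.lookup f) ?E) ` (homogeneous_part d :: ('n, 'k) mpoly set) \<subseteq> PiE ?E (\<lambda>_. UNIV)"
    unfolding image_subset_iff restrict_PiE_iff by (intro ballI UNIV_I)
qed

section \<open>Frobenius powers\<close>

lemma single_mem_frobenius_power:
  assumes "r \<le> Poly_Mapping.lookup e i"
  shows "Poly_Mapping.single e c \<in> frobenius_power r"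
proof -
  have "e = (e - Poly_Mapping.single i r) + Poly_Mapping.single i r"
    by (rule poly_mapping_eqI)
       (use assms in \<open>auto simp: lookup_add lookup_minus lookup_single when_def\<close>)
  then have "Poly_Mapping.single e c = Poly_Mapping.single (e - Poly_Mapping.single i r) c * mvar i ^ r"
    by (metis mvar_power mult_single mult.right_neutral)
  then show ?thesis
    unfolding frobenius_power_def
    by (metis mpoly_ideal.span_base mpoly_ideal.span_scale rangeI)
qed

text \<open>The ideal is generated by monomials, so membership is decided term by term and becomes a
  condition on exponents.\<close>

lemma frobenius_power_iff:
  "f \<in> frobenius_power r \<longleftrightarrow> (\<forall>e\<in>Poly_Mapping.keys f. \<exists>i. r \<le> Poly_Mapping.lookup e i)"
proof
  assume "f \<in> frobenius_power r"
  then show "\<forall>e\<in>Poly_Mapping.keys f. \<exists>i. r \<le> Poly_Mapping.lookup e i"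
    unfolding frobenius_power_def
  proof (induction rule: mpoly_ideal.span_induct_alt)
    case base
    show ?case by simp
  next
    case (step c x y)
    then obtain i where i: "x = mvar i ^ r" by auto
    show ?case
    proof
      fix e assume "e \<in> Poly_Mapping.keys (c * x + y)"
      then consider "e \<in> Poly_Mapping.keys (c * x)" | "e \<in> Poly_Mapping.keys y"
        using keys_add[of "c * x" y] by blast
      then show "\<exists>i. r \<le> Poly_Mapping.lookup e i"
      proof cases
        case 1
        then have "r \<le> Poly_Mapping.lookup e i"
          using keys_mult[of c x] by (auto simp: i mvar_power lookup_add lookup_single split: if_splits)
        then show ?thesis ..
      qed (use step in auto)
    qed
  qed
next
  assume *: "\<forall>e\<in>Poly_Mapping.keys f. \<exists>i. r \<le> Poly_Mapping.lookup e i"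
  have "f = (\<Sum>e\<in>Poly_Mapping.keys f. Poly_Mapping.single e (Poly_Mapping.lookup f e))"
    by (rule poly_mapping_sum_single[symmetric])
  also have "\<dots> \<in> frobenius_power r"
    unfolding frobenius_power_def
  proof (rule mpoly_ideal.span_sum)
    fix e assume "e \<in> Poly_Mapping.keys f"
    then obtain i where "r \<le> Poly_Mapping.lookup e i"
      using * by blast
    from single_mem_frobenius_power[OF this]
    show "Poly_Mapping.single e (Poly_Mapping.lookup f e) \<in> mpoly_ideal.span (range (\<lambda>i. mvar i ^ r))"
      by (simp only: frobenius_power_def)
  qed
  finally show "f \<in> frobenius_power r" .
qed

lemma frobenius_power_0: "0 \<in> frobenius_power r"
  and frobenius_power_add: "f \<in> frobenius_power r \<Longrightarrow> h \<in> frobenius_power r \<Longrightarrow> f + h \<in> frobenius_power r"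
  and frobenius_power_diff: "f \<in> frobenius_power r \<Longrightarrow> h \<in> frobenius_power r \<Longrightarrow> f - h \<in> frobenius_power r"
  and frobenius_power_mult: "h \<in> frobenius_power r \<Longrightarrow> f * h \<in> frobenius_power r"
  unfolding frobenius_power_def
  by (simp_all add: mpoly_ideal.span_zero mpoly_ideal.span_add mpoly_ideal.span_diff mpoly_ideal.span_scale)

lemma subspace_frobenius_power: "mpoly_vs.subspace (frobenius_power r)"
  unfolding mpoly_vs.subspace_def mscale_def
  by (simp add: frobenius_power_0 frobenius_power_add frobenius_power_mult)

section \<open>Finite fields and the Frobenius endomorphism\<close>

lemma field_power_card:
  fixes a :: "'k::{field, finite}"
  shows "a ^ CARD('k) = a"
proof (cases "a = 0")
  case True
  then show ?thesis by (simp add: zero_power)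
next
  case False
  \<comment> \<open>Multiplication by \<open>a\<close> permutes the nonzero elements; comparing the
    products of all of them gives a^(q-1) = 1.\<close>
  have "(\<Prod>x\<in>-{0}. x) = (\<Prod>x\<in>-{0}. a * x)"
    by (rule prod.reindex_bij_witness[of _ "\<lambda>x. a * x" "\<lambda>x. x / a"]) (use False in auto)
  also have "\<dots> = a ^ card (-{0::'k}) * (\<Prod>x\<in>-{0}. x)"
    by (simp add: prod.distrib)
  finally have "a ^ card (-{0::'k}) = 1" by simp
  moreover have "CARD('k) = Suc (card (-{0::'k}))"
    by (simp add: Compl_eq_Diff_UNIV card_Suc_Diff1 del: card_Diff_insert)
  ultimately show ?thesis by simp
qed

lemma field_power_card_power:
  fixes a :: "'k::{field, finite}"
  shows "a ^ (CARD('k) ^ m) = a"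
  by (induction m) (simp_all add: power_mult field_power_card)

text \<open>As functions on the field, (a + 1)^q = a + 1 = a^q + 1. Hence the middle part of the
  binomial expansion is a polynomial of degree below q with q roots, and so is zero. This avoids any
  appeal to the characteristic.\<close>

lemma of_nat_card_choose:
  assumes "0 < k" "k < CARD('k)"
  shows "of_nat (CARD('k::{field, finite}) choose k) = (0 :: 'k::{field, finite})"
proof -
  let ?q = "CARD('k)"
  define p :: "'k poly" where "p = (\<Sum>k\<in>{0<..<?q}. monom (of_nat (?q choose k)) k)"
  have "degree p < ?q"
    unfolding p_def by (rule degree_sum_less) (auto intro: le_less_trans[OF degree_monom_le])
  have "poly p a = 0" for a
  proof -
    have "{..?q} = insert 0 (insert ?q {0<..<?q})" by auto
    moreover have "a + 1 = (\<Sum>k\<le>?q. of_nat (?q choose k) * a ^ k)"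
      using binomial_ring[of a 1 ?q] by (simp add: field_power_card)
    ultimately have "a + 1 = 1 + (a ^ ?q + (\<Sum>k\<in>{0<..<?q}. of_nat (?q choose k) * a ^ k))"
      by simp
    then show ?thesis by (simp add: p_def poly_sum poly_monom field_power_card)
  qed
  then have "p = 0"
    using \<open>degree p < ?q\<close> card_poly_roots_bound[of p] by fastforce
  then have "coeff p k = 0" by simp
  then show ?thesis
    using assms by (simp add: p_def coeff_sum)
qed

lemma mpoly_add_power_card:
  fixes f h :: "('n, 'k::{field, finite}) mpoly"
  shows "(f + h) ^ (CARD('k) ^ m) = f ^ (CARD('k) ^ m) + h ^ (CARD('k) ^ m)"
proof -
  let ?q = "CARD('k)"
  have *: "(f + h) ^ ?q = f ^ ?q + h ^ ?q" for f h :: "('n, 'k) mpoly"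
  proof -
    have "of_nat (?q choose k) = (0 :: ('n, 'k) mpoly)" if "k \<in> {0<..<?q}" for k
      using of_nat_card_choose[of k, where 'k = 'k] that
      by (metis mconst_of_nat mconst_simps(1) greaterThanLessThan_iff)
    then have "(\<Sum>k\<in>{0<..<?q}. of_nat (?q choose k) * f ^ k * h ^ (?q - k)) = 0"
      by (intro sum.neutral) simp
    moreover have "{..?q} = insert 0 (insert ?q {0<..<?q})" by auto
    ultimately show ?thesis by (simp add: binomial_ring[of f h])
  qed
  show ?thesis
  proof (induction m)
    case (Suc m)
    then show ?case by (simp only: power_Suc2 power_mult *)
  qed simp
qed

text \<open>Raising to the power q^m is additive and fixes the scalars, so the power of any linear
  form is a combination of the powers of the variables. This is why the Frobenius power is stable
  under linear substitutions.\<close>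

lemma linform_power_card:
  fixes w :: "'n::finite \<Rightarrow> 'k::{field, finite}"
  shows "linform w ^ (CARD('k) ^ m) = (\<Sum>i\<in>UNIV. mconst (w i) * mvar i ^ (CARD('k) ^ m))"
proof -
  have "(\<Sum>i\<in>I. f i) ^ (CARD('k) ^ m) = (\<Sum>i\<in>I. f i ^ (CARD('k) ^ m))"
    if "finite I" for I and f :: "'n \<Rightarrow> ('n, 'k) mpoly"
    using that by induction (simp_all add: mpoly_add_power_card zero_power)
  then show ?thesis
    unfolding linform_def
    by (simp add: power_mult_distrib field_power_card_power flip: mconst_power)
qed

lemma linform_power_mem:
  fixes w :: "'n::finite \<Rightarrow> 'k::{field, finite}"
  shows "linform w ^ (CARD('k) ^ m) \<in> frobenius_power (CARD('k) ^ m)"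
  unfolding linform_power_card frobenius_power_def
  by (intro mpoly_ideal.span_sum mpoly_ideal.span_scale mpoly_ideal.span_base rangeI)

lemma subst_act_frobenius_power:
  fixes f :: "('n::finite, 'k::{field, finite}) mpoly"
  assumes "f \<in> frobenius_power (CARD('k) ^ m)"
  shows "subst_act g f \<in> frobenius_power (CARD('k) ^ m)"
  using assms unfolding frobenius_power_def[of "CARD('k) ^ m"]
proof (induction rule: mpoly_ideal.span_induct_alt)
  case base
  then show ?case by (simp add: subst_act_0 mpoly_ideal.span_zero)
next
  case (step c x y)
  then obtain i where x: "x = mvar i ^ (CARD('k) ^ m)" by auto
  have "subst_act g x \<in> frobenius_power (CARD('k) ^ m)"
    unfolding x subst_act_power subst_act_mvar by (rule linform_power_mem)
  then show ?case using step
    by (simp add: subst_act_add subst_act_mult frobenius_power_def mpoly_ideal.span_add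
        mpoly_ideal.span_scale)
qed

section \<open>Invariance of the socle coefficient\<close>

definition const_exponent :: "nat \<Rightarrow> 'n::finite \<Rightarrow>\<^sub>0 nat" where
  "const_exponent k = Abs_poly_mapping (\<lambda>_. k)"

lemma lookup_const_exponent [simp]: "Poly_Mapping.lookup (const_exponent k) i = k"
  by (simp add: const_exponent_def)

text \<open>The functional \<tau> of the overview.\<close>

definition top_coeff :: "nat \<Rightarrow> ('n::finite, 'k::comm_ring_1) mpoly \<Rightarrow> 'k" where
  "top_coeff r f = Poly_Mapping.lookup f (const_exponent (r - 1))"

lemma top_coeff_0: "top_coeff r 0 = 0"
  and top_coeff_add: "top_coeff r (f + h) = top_coeff r f + top_coeff r h"
  and top_coeff_diff: "top_coeff r (f - h) = top_coeff r f - top_coeff r h"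
  and top_coeff_sum: "top_coeff r (\<Sum>i\<in>I. F i) = (\<Sum>i\<in>I. top_coeff r (F i))"
  and top_coeff_mconst: "top_coeff r (mconst c * f) = c * top_coeff r f"
  and top_coeff_mscale: "top_coeff r (mscale c f) = c * top_coeff r f"
  by (simp_all add: top_coeff_def lookup_add lookup_minus lookup_sum lookup_mconst_mult mscale_def)

text \<open>No entry of the socle exponent reaches \<open>r\<close>, so \<tau> is well defined on
  the quotient.\<close>

lemma top_coeff_frobenius_power:
  assumes "f \<in> frobenius_power r" "0 < r"
  shows "top_coeff r f = 0"
proof (rule ccontr)
  assume "top_coeff r f \<noteq> 0"
  then have "const_exponent (r - 1) \<in> Poly_Mapping.keys f"
    by (simp add: top_coeff_def in_keys_iff)
  then obtain i :: 'a where "r \<le> Poly_Mapping.lookup (const_exponent (r - 1)) i"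
    using assms(1) frobenius_power_iff by metis
  then show False using assms(2) by simp
qed

lemma top_coeff_homogeneous:
  fixes f :: "('n::finite, 'k::comm_ring_1) mpoly"
  assumes "f \<in> homogeneous_part d" "d \<noteq> CARD('n) * (r - 1)"
  shows "top_coeff r f = 0"
proof (rule ccontr)
  assume "top_coeff r f \<noteq> 0"
  then have "const_exponent (r - 1) \<in> Poly_Mapping.keys f"
    by (simp add: top_coeff_def in_keys_iff)
  then have "(\<Sum>i\<in>UNIV. Poly_Mapping.lookup (const_exponent (r - 1)) (i :: 'n)) = d"
    using assms(1) unfolding homogeneous_part_def by blast
  then show False using assms(2) by simp
qed

section \<open>Products of powers of linear forms under column operations\<close>

lemma dvd_mult_diff_mult:
  fixes x :: "'a::comm_ring_1"
  assumes "x dvd a - b" "x dvd c - d"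
  shows "x dvd a * c - b * d"
proof -
  have "a * c - b * d = (a - b) * c + b * (c - d)" by (simp add: algebra_simps)
  then show ?thesis using assms by (metis dvd_add dvd_mult dvd_mult2)
qed

lemma dvd_power_diff_power:
  fixes x :: "'a::comm_ring_1"
  assumes "x dvd a - b"
  shows "x dvd a ^ k - b ^ k"
  by (induction k) (simp_all add: dvd_mult_diff_mult assms)

lemma dvd_prod_diff_prod:
  fixes x :: "'a::comm_ring_1"
  assumes "\<And>i. i \<in> I \<Longrightarrow> x dvd f i - h i"
  shows "x dvd (\<Prod>i\<in>I. f i) - (\<Prod>i\<in>I. h i)"
  using assms by (induction I rule: infinite_finite_induct) (simp_all add: dvd_mult_diff_mult)

text \<open>With \<open>v j\<close> the \<open>j\<close>-th column of \<open>g\<close>, this is the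
  image of the socle monomial under \<open>g\<close>. Arbitrary families are allowed so that the
  columns can be changed one by one.\<close>

definition linform_prod :: "nat \<Rightarrow> ('n \<Rightarrow> 'n \<Rightarrow> 'k) \<Rightarrow> ('n::finite, 'k::comm_ring_1) mpoly" where
  "linform_prod r v = (\<Prod>j\<in>UNIV. linform (v j) ^ (r - 1))"

lemma linform_prod_scale:
  fixes v :: "'n::finite \<Rightarrow> 'n \<Rightarrow> 'k::{field, finite}"
  assumes "r = CARD('k) ^ m" "a \<noteq> 0"
  shows "linform_prod r (v(j := \<lambda>i. a * v j i)) = linform_prod r v"
proof -
  have "a * a ^ (r - 1) = a * 1"
    using field_power_card_power[of a m] assms(1)
    by (metis mult.right_neutral power_eq_if power_not_zero zero_less_card_finite less_numeral_extra(3))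
  then have a: "a ^ (r - 1) = 1" using assms(2) mult_cancel_left by blast
  have "linform ((v(j := \<lambda>i. a * v j i)) k) ^ (r - 1) = linform (v k) ^ (r - 1)" for k
    using a by (simp add: linform_scale power_mult_distrib mconst_simps flip: mconst_power)
  then show ?thesis by (simp add: linform_prod_def)
qed

lemma linform_prod_clear:
  fixes v w :: "'n::finite \<Rightarrow> 'n \<Rightarrow> 'k::{field, finite}"
  assumes r: "r = CARD('k) ^ m" and j: "w j = v j"
    and w: "\<And>k i. k \<noteq> j \<Longrightarrow> w k i = v k i + c k * v j i"
  shows "linform_prod r w - linform_prod r v \<in> frobenius_power r"
proof -
  have "0 < r" using r by simp
  have split: "linform_prod r u = linform (u j) ^ (r - 1) * (\<Prod>k\<in>UNIV-{j}. linform (u k) ^ (r - 1))" for u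
    unfolding linform_prod_def by (simp add: prod.remove)
  \<comment> \<open>Modulo the pivot form the other factors do not change. The quotient
    \<open>u\<close>, the pivot form and the factor \<open>linform (v j) ^ (r - 1)\<close> then
    combine to a multiple of the \<open>r\<close>-th power.\<close>
  have "linform (v j) dvd (\<Prod>k\<in>UNIV-{j}. linform (w k) ^ (r - 1)) - (\<Prod>k\<in>UNIV-{j}. linform (v k) ^ (r - 1))"
  proof (intro dvd_prod_diff_prod dvd_power_diff_power)
    fix k assume "k \<in> UNIV - {j}"
    then have "w k = (\<lambda>i. v k i + c k * v j i)" using w by auto
    then have "linform (w k) = linform (v k) + mconst (c k) * linform (v j)"
      by (simp only: linform_add linform_scale)
    then show "linform (v j) dvd linform (w k) - linform (v k)" by simp
  qed
  then obtain u where "(\<Prod>k\<in>UNIV-{j}. linform (w k) ^ (r - 1)) - (\<Prod>k\<in>UNIV-{j}. linform (v k) ^ (r - 1))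
      = linform (v j) * u" by blast
  then have "linform_prod r w - linform_prod r v = u * (linform (v j) ^ (r - 1) * linform (v j))"
    by (simp add: split j mult_ac flip: right_diff_distrib)
  also have "linform (v j) ^ (r - 1) * linform (v j) = linform (v j) ^ r"
    using \<open>0 < r\<close> by (metis power_minus_mult)
  finally show ?thesis
    using linform_power_mem[of "v j" m] by (simp add: r frobenius_power_mult)
qed

text \<open>The forms \<open>v j\<close> have no common zero but the origin. In this form the
  condition passes easily through scaling and clearing, and its failure is exactly what a missing
  pivot produces; no determinant occurs.\<close>

definition nondegenerate :: "('n::finite \<Rightarrow> 'n \<Rightarrow> 'k::field) \<Rightarrow> bool" where
  "nondegenerate v \<longleftrightarrow> (\<forall>y. (\<forall>j. (\<Sum>i\<in>UNIV. y i * v j i) = 0) \<longrightarrow> (\<forall>i. y i = 0))"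

text \<open>
  Scaling a form does not change \<open>linform_prod\<close> since \<open>a\<^bsup>r-1\<^esup> = 1\<close>, and adding multiples of one form
  \<open>l\<close> to the others changes it by a multiple of \<open>l\<^sup>r\<close>; so Gaussian elimination applies.
\<close>

lemma column_reduction:
  fixes v :: "'n::finite \<Rightarrow> 'n \<Rightarrow> 'k::{field, finite}" and I :: "'n set"
  assumes r: "r = CARD('k) ^ m" and v: "nondegenerate v" and I: "finite I"
  shows "\<exists>w \<sigma>. nondegenerate w \<and> top_coeff r (linform_prod r w) = top_coeff r (linform_prod r v) \<and>
    inj_on \<sigma> I \<and> (\<forall>i\<in>I. \<forall>j. w j i = (if j = \<sigma> i then 1 else 0))"
  using I
proof (induction I rule: finite_induct)
  case empty
  show ?case by (rule exI[of _ v], rule exI[of _ id]) (simp add: v)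
next
  case (insert i I)
  then obtain w \<sigma> where w: "nondegenerate w"
    and top: "top_coeff r (linform_prod r w) = top_coeff r (linform_prod r v)"
    and inj: "inj_on \<sigma> I" and wI: "\<And>k j. k \<in> I \<Longrightarrow> w j k = (if j = \<sigma> k then 1 else 0)"
    by blast
  have "\<exists>j. j \<notin> \<sigma> ` I \<and> w j i \<noteq> 0"
  proof (rule ccontr)
    assume "\<not> ?thesis"
    then have neg: "w j i = 0" if "j \<notin> \<sigma> ` I" for j using that by blast
    \<comment> \<open>Without a pivot, the coefficients at \<open>i\<close> of all forms are a
      combination of those at the reduced positions \<open>k\<close> in \<open>I\<close>, with
      weights \<open>w (\<sigma> k) i\<close>. \<open>y\<close> is this linear relation, normalised
      to 1 at \<open>i\<close>.\<close>
    define y where "y k = (if k = i then 1 else if k \<in> I then - w (\<sigma> k) i else 0)" for k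
    have "(\<Sum>k\<in>UNIV. y k * w j k) = 0" for j
    proof -
      have "(\<Sum>k\<in>UNIV. y k * w j k) = (\<Sum>k\<in>insert i I. y k * w j k)"
        by (rule sum.mono_neutral_right) (auto simp: y_def)
      also have "\<dots> = w j i + (\<Sum>k\<in>I. y k * w j k)"
        using insert.hyps by (simp add: y_def)
      also have "(\<Sum>k\<in>I. y k * w j k) = (\<Sum>k\<in>I. if j = \<sigma> k then - w j i else 0)"
        using insert.hyps by (intro sum.cong) (auto simp: y_def wI)
      also have "w j i + \<dots> = 0"
      proof (cases "j \<in> \<sigma> ` I")
        case True
        then obtain k0 where k0: "k0 \<in> I" "j = \<sigma> k0" by blast
        then have "(\<Sum>k\<in>I. if j = \<sigma> k then - w j i else 0) = (\<Sum>k\<in>I. if k = k0 then - w j i else 0)"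
          using inj by (intro sum.cong) (auto dest: inj_onD)
        then show ?thesis using k0 insert.hyps by simp
      next
        case False
        then have "(\<Sum>k\<in>I. if j = \<sigma> k then - w j i else 0) = 0"
          by (intro sum.neutral) auto
        then show ?thesis using neg[OF False] by simp
      qed
      finally show ?thesis .
    qed
    then have "y i = 0" using w unfolding nondegenerate_def by blast
    then show False by (simp add: y_def)
  qed
  then obtain j where j: "j \<notin> \<sigma> ` I" "w j i \<noteq> 0" by blast
  define a where "a = inverse (w j i)"
  define w1 where "w1 = w(j := \<lambda>k. a * w j k)"
  define w2 where "w2 k = (if k = j then w1 j else (\<lambda>l. w1 k l + (- w k i) * w1 j l))" for k
  have a: "a \<noteq> 0" "a * w j i = 1" using j by (simp_all add: a_def)
  have w1_top: "linform_prod r w1 = linform_prod r w"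
    unfolding w1_def by (rule linform_prod_scale[OF r a(1)])
  have "linform_prod r w2 - linform_prod r w1 \<in> frobenius_power r"
    by (rule linform_prod_clear[OF r, where j = j and c = "\<lambda>k. - w k i"]) (simp_all add: w2_def)
  then have "top_coeff r (linform_prod r w2 - linform_prod r w1) = 0"
    by (rule top_coeff_frobenius_power) (simp add: r)
  then have top2: "top_coeff r (linform_prod r w2) = top_coeff r (linform_prod r v)"
    by (simp add: top_coeff_diff w1_top top)
  \<comment> \<open>Both operations can be undone, so a common zero of the new forms is one of the
    old forms.\<close>
  have "nondegenerate w2"
    unfolding nondegenerate_def
  proof (rule allI, rule impI)
    fix y assume y: "\<forall>k. (\<Sum>l\<in>UNIV. y l * w2 k l) = 0"
    have *: "(\<Sum>l\<in>UNIV. y l * w1 j l) = 0"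
      using y[rule_format, of j] by (simp add: w2_def)
    have "(\<Sum>l\<in>UNIV. y l * w1 k l) = 0" for k
    proof (cases "k = j")
      case False
      have "(\<Sum>l\<in>UNIV. y l * w1 k l) = (\<Sum>l\<in>UNIV. y l * w2 k l) + w k i * (\<Sum>l\<in>UNIV. y l * w1 j l)"
        unfolding sum_distrib_left sum.distrib[symmetric]
        using False by (intro sum.cong) (simp_all add: w2_def algebra_simps)
      then show ?thesis using y * by simp
    qed (use * in simp)
    note 1 = this
    have "(\<Sum>l\<in>UNIV. y l * w k l) = 0" for k
    proof (cases "k = j")
      case True
      have "a * (\<Sum>l\<in>UNIV. y l * w j l) = (\<Sum>l\<in>UNIV. y l * w1 j l)"
        by (simp add: sum_distrib_left w1_def mult_ac)
      then show ?thesis using True a 1 by simp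
    next
      case False
      then show ?thesis using 1[of k] by (simp add: w1_def)
    qed
    then show "\<forall>i. y i = 0" using w unfolding nondegenerate_def by blast
  qed
  moreover have "inj_on (\<sigma>(i := j)) (insert i I)"
    using inj j insert.hyps by (auto simp: inj_on_def)
  \<comment> \<open>The earlier positions stay reduced: \<open>j\<close> is not the pivot of any
    \<open>k\<close> in \<open>I\<close>, so the pivot form has coefficient 0 at \<open>k\<close>
    and clearing with it changes nothing there.\<close>
  moreover have "w2 l k = (if l = (\<sigma>(i := j)) k then 1 else 0)" if "k \<in> insert i I" for k l
  proof (cases "k = i")
    case True
    then show ?thesis by (simp add: w2_def w1_def a)
  next
    case False
    then have "k \<in> I" using that by simp
    moreover from this have "j \<noteq> \<sigma> k" using j by blast
    ultimately show ?thesis using False by (simp add: w2_def w1_def wI)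
  qed
  ultimately show ?case using top2 by blast
qed

text \<open>Complete reduction leaves the variables, permuted by \<sigma>, and then the product is
  the socle monomial itself.\<close>

lemma top_coeff_linform_prod:
  fixes v :: "'n::finite \<Rightarrow> 'n \<Rightarrow> 'k::{field, finite}"
  assumes r: "r = CARD('k) ^ m" and v: "nondegenerate v"
  shows "top_coeff r (linform_prod r v) = 1"
proof -
  obtain w \<sigma> where top: "top_coeff r (linform_prod r w) = top_coeff r (linform_prod r v)"
    and inj: "inj (\<sigma> :: 'n \<Rightarrow> 'n)" and w: "\<And>i j. w j i = (if j = \<sigma> i then 1 else 0)"
    using column_reduction[OF r v, of UNIV] by auto
  have "bij \<sigma>" using inj by (simp add: bij_def finite_UNIV_inj_surj)
  have "linform (w (\<sigma> i)) = mvar i" for i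
  proof -
    have "w (\<sigma> i) = (\<lambda>k. if k = i then 1 else 0)"
      using inj by (auto simp: w inj_eq)
    then show ?thesis by (simp add: linform_delta)
  qed
  moreover have "linform_prod r w = (\<Prod>i\<in>UNIV. linform (w (\<sigma> i)) ^ (r - 1))"
    unfolding linform_prod_def
    by (rule prod.reindex_bij_betw[OF \<open>bij \<sigma>\<close>, symmetric])
  ultimately have "linform_prod r w = Poly_Mapping.single (const_exponent (r - 1)) 1"
    by (simp add: single_eq_monomial mconst_simps)
  then show ?thesis using top by (simp add: top_coeff_def)
qed

lemma invertible_nondegenerate:
  assumes "invertible g"
  shows "nondegenerate (\<lambda>j i. g $ i $ j)"
  unfolding nondegenerate_def
proof (rule allI, rule impI)
  fix y assume y: "\<forall>j. (\<Sum>i\<in>UNIV. y i * g $ i $ j) = 0"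
  obtain h where h: "g ** h = mat 1" using assms by (auto simp: invertible_def)
  have "y l = 0" for l
  proof -
    have "y l = (\<Sum>i\<in>UNIV. y i * (g ** h) $ i $ l)"
    proof -
      have "(\<Sum>i\<in>UNIV. y i * (g ** h) $ i $ l) = (\<Sum>i\<in>UNIV. if i = l then y i else 0)"
        unfolding h mat_def by (intro sum.cong) auto
      then show ?thesis by simp
    qed
    also have "\<dots> = (\<Sum>i\<in>UNIV. \<Sum>j\<in>UNIV. y i * g $ i $ j * h $ j $ l)"
      by (simp add: matrix_matrix_mult_def sum_distrib_left mult.assoc[symmetric])
    also have "\<dots> = (\<Sum>j\<in>UNIV. \<Sum>i\<in>UNIV. y i * g $ i $ j * h $ j $ l)"
      by (rule sum.swap)
    also have "\<dots> = (\<Sum>j\<in>UNIV. (\<Sum>i\<in>UNIV. y i * g $ i $ j) * h $ j $ l)"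
      by (simp add: sum_distrib_right)
    finally show ?thesis using y by simp
  qed
  then show "\<forall>i. y i = 0" by blast
qed

text \<open>Only the socle monomial needs the elimination. Any other monomial either has an exponent
  of at least \<open>r\<close> and lies in the stable ideal, or has total degree below that of the
  socle. Both properties are preserved by \<open>g\<close> and force \<tau> to vanish.\<close>

lemma top_coeff_subst_act:
  fixes f :: "('n::finite, 'k::{field, finite}) mpoly"
  assumes r: "r = CARD('k) ^ m" and g: "invertible g"
  shows "top_coeff r (subst_act g f) = top_coeff r f"
proof (induction f rule: poly_mapping_induct)
  case (single e c)
  have r0: "0 < r" by (simp add: r)
  consider "e = const_exponent (r - 1)" | i where "r \<le> Poly_Mapping.lookup e i"
    | i where "e \<noteq> const_exponent (r - 1)" "\<And>i. Poly_Mapping.lookup e i \<le> r - 1" "Poly_Mapping.lookup e i < r - 1"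
  proof -
    have "\<exists>i. Poly_Mapping.lookup e i < r - 1"
      if "\<forall>i. Poly_Mapping.lookup e i \<le> r - 1" "e \<noteq> const_exponent (r - 1)"
    proof (rule ccontr)
      assume "\<nexists>i. Poly_Mapping.lookup e i < r - 1"
      then have "Poly_Mapping.lookup e i = Poly_Mapping.lookup (const_exponent (r - 1)) i" for i
        using that(1) by (simp add: le_antisym not_less)
      then show False using that(2) poly_mapping_eqI by blast
    qed
    moreover have "Poly_Mapping.lookup e i \<le> r - 1" if "\<not> r \<le> Poly_Mapping.lookup e i" for i
      using that r0 by linarith
    ultimately show ?thesis using that by blast
  qed
  then show ?case
  proof cases
    case 1
    have "subst_act g (Poly_Mapping.single e c) = mconst c * linform_prod r (\<lambda>j i. g $ i $ j)"
      unfolding 1 by (simp add: subst_act_single linform_prod_def)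
    then show ?thesis
      using top_coeff_linform_prod[OF r invertible_nondegenerate[OF g]]
      by (simp add: top_coeff_mconst) (simp add: top_coeff_def 1)
  next
    case 2
    from single_mem_frobenius_power[OF this, of c]
    have *: "Poly_Mapping.single e c \<in> frobenius_power (CARD('k) ^ m)" by (simp add: r)
    from this subst_act_frobenius_power[OF this, of g] show ?thesis
      using r0 unfolding r by (simp add: top_coeff_frobenius_power)
  next
    case 3
    define d where "d = (\<Sum>i\<in>UNIV. Poly_Mapping.lookup e i)"
    have "d < (\<Sum>i\<in>(UNIV :: 'n set). r - 1)"
      unfolding d_def by (rule sum_strict_mono_ex1) (use 3 in auto)
    then have d: "d \<noteq> CARD('n) * (r - 1)" by simp
    have "Poly_Mapping.single e c \<in> homogeneous_part d"
      by (rule homogeneous_single) (simp add: d_def)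
    from this homogeneous_subst_act[OF this, of g] show ?thesis
      using d by (simp add: top_coeff_homogeneous)
  qed
next
  case (add f g)
  then show ?case by (simp add: subst_act_add top_coeff_add)
qed

section \<open>Dimensions of quotients\<close>

lemma coset_eq_iff:
  assumes "mpoly_vs.subspace W"
  shows "f +o W = h +o W \<longleftrightarrow> f - h \<in> W"
proof
  assume "f +o W = h +o W"
  moreover have "f \<in> f +o W"
    using mpoly_vs.subspace_0[OF assms] by (force simp: elt_set_plus_def)
  ultimately show "f - h \<in> W" by (auto simp: elt_set_plus_def)
next
  assume *: "f - h \<in> W"
  have sub: "f +o W \<subseteq> h +o W" if "f - h \<in> W" for f h
  proof
    fix x assume "x \<in> f +o W"
    then obtain w where w: "w \<in> W" "x = f + w" by (auto simp: elt_set_plus_def)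
    then have "(f - h) + w \<in> W" using that assms mpoly_vs.subspace_add by blast
    moreover have "x = h + ((f - h) + w)" by (simp add: w)
    ultimately show "x \<in> h +o W" unfolding elt_set_plus_def by blast
  qed
  have "h - f \<in> W" using mpoly_vs.subspace_neg[OF assms *] by simp
  then show "f +o W = h +o W" using * sub by blast
qed

text \<open>For a subspace \<open>V\<close>, these are representatives of a basis of the image of
  \<open>V\<close> in the quotient by \<open>W\<close>. Coefficients attach to polynomials, so that
  linear algebra uses ordinary sums instead of sums of cosets.\<close>

definition basis_mod ::
  "('n, 'k::field) mpoly set \<Rightarrow> ('n, 'k) mpoly set \<Rightarrow> ('n, 'k) mpoly set \<Rightarrow> bool" where
  "basis_mod W V E \<longleftrightarrow> finite E \<and> E \<subseteq> V \<and>
     (\<forall>c. (\<Sum>e\<in>E. mscale (c e) e) \<in> W \<longrightarrow> (\<forall>e\<in>E. c e = 0)) \<and>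
     (\<forall>v\<in>V. \<exists>c. v - (\<Sum>e\<in>E. mscale (c e) e) \<in> W)"

text \<open>A maximal subset independent modulo \<open>W\<close> spans: a dependency that appears
  when \<open>v\<close> is added must involve \<open>v\<close>, which can then be solved for.
  Finiteness of \<open>V\<close> provides the maximal subset.\<close>

lemma ex_basis_mod:
  assumes W: "mpoly_vs.subspace W" and fin: "finite V"
  shows "\<exists>E. basis_mod W V E"
proof -
  define indep where "indep E \<longleftrightarrow> E \<subseteq> V \<and>
    (\<forall>c. (\<Sum>e\<in>E. mscale (c e) e) \<in> W \<longrightarrow> (\<forall>e\<in>E. c e = 0))" for E
  have "finite {E. indep E}"
    by (rule finite_subset[of _ "Pow V"]) (use fin in \<open>auto simp: indep_def\<close>)
  moreover have "indep {}" by (simp add: indep_def)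
  ultimately obtain E where E: "indep E" and max: "\<And>E'. indep E' \<Longrightarrow> E \<subseteq> E' \<Longrightarrow> E' = E"
    using finite_has_maximal2[of "{E. indep E}" "{}"] by (metis mem_Collect_eq)
  have finE: "finite E" using E fin by (auto simp: indep_def intro: finite_subset)
  have "\<exists>c. v - (\<Sum>e\<in>E. mscale (c e) e) \<in> W" if v: "v \<in> V" for v
  proof (cases "v \<in> E")
    case True
    have "(\<Sum>e\<in>E. mscale (if e = v then 1 else 0) e) = (\<Sum>e\<in>E. if e = v then e else 0)"
      by (intro sum.cong) auto
    then have "v - (\<Sum>e\<in>E. mscale (if e = v then 1 else 0) e) \<in> W"
      using True finE W by (simp add: mpoly_vs.subspace_0)
    then show ?thesis by (rule exI[of _ "\<lambda>e. if e = v then 1 else 0"])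
  next
    case False
    then have "\<not> indep (insert v E)" using max[of "insert v E"] by blast
    then obtain c where c: "(\<Sum>e\<in>insert v E. mscale (c e) e) \<in> W" "\<exists>e\<in>insert v E. c e \<noteq> 0"
      using E v by (auto simp only: indep_def insert_subset)
    then have sum: "mscale (c v) v + (\<Sum>e\<in>E. mscale (c e) e) \<in> W"
      using False finE by simp
    have "c v \<noteq> 0"
    proof
      assume "c v = 0"
      with sum E c(2) show False by (auto simp: indep_def)
    qed
    have "mscale (inverse (c v)) (mscale (c v) v + (\<Sum>e\<in>E. mscale (c e) e)) \<in> W"
      using W sum by (rule mpoly_vs.subspace_scale)
    moreover have "mscale (inverse (c v)) (mscale (c v) v + (\<Sum>e\<in>E. mscale (c e) e)) =
        v - (\<Sum>e\<in>E. mscale (- inverse (c v) * c e) e)"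
      using \<open>c v \<noteq> 0\<close>
      by (simp add: mpoly_vs.scale_right_distrib mpoly_vs.scale_sum_right sum_negf)
    ultimately show ?thesis by metis
  qed
  then show ?thesis
    using E unfolding basis_mod_def indep_def by (intro exI[of _ E] conjI ballI finE) simp_all
qed

lemma basis_mod_indepD:
  "basis_mod W V E \<Longrightarrow> (\<Sum>e\<in>E. mscale (c e) e) \<in> W \<Longrightarrow> e \<in> E \<Longrightarrow> c e = 0"
  unfolding basis_mod_def by simp

lemma basis_mod_spanD:
  "basis_mod W V E \<Longrightarrow> v \<in> V \<Longrightarrow> \<exists>c. v - (\<Sum>e\<in>E. mscale (c e) e) \<in> W"
  unfolding basis_mod_def by simp

lemma sum_mscale_diff:
  fixes E :: "('n, 'k::field) mpoly set"
  shows "(\<Sum>e\<in>E. mscale (c e) e) - (\<Sum>e\<in>E. mscale (c' e) e) = (\<Sum>e\<in>E. mscale (c e - c' e) e)"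
  by (simp add: mpoly_vs.scale_left_diff_distrib sum_subtractf)

lemma basis_mod_unique:
  assumes W: "mpoly_vs.subspace W" and E: "basis_mod W V E"
    and "v - (\<Sum>e\<in>E. mscale (c e) e) \<in> W" "v - (\<Sum>e\<in>E. mscale (c' e) e) \<in> W" "e \<in> E"
  shows "c e = c' e"
proof -
  have "(v - (\<Sum>e\<in>E. mscale (c' e) e)) - (v - (\<Sum>e\<in>E. mscale (c e) e)) \<in> W"
    using W assms(4,3) by (rule mpoly_vs.subspace_diff)
  then have "(\<Sum>e\<in>E. mscale (c e - c' e) e) \<in> W"
    by (simp flip: sum_mscale_diff)
  from basis_mod_indepD[OF E this \<open>e \<in> E\<close>] show ?thesis by simp
qed

text \<open>The coefficients in \<open>coset_basis\<close> are indexed by cosets, so distinct basis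
  elements must not share one. If they did, one element would have two different indicator
  expansions modulo \<open>W\<close>.\<close>

lemma basis_mod_inj:
  assumes W: "mpoly_vs.subspace W" and E: "basis_mod W V E"
  shows "inj_on (\<lambda>f. f +o W) E"
proof (rule inj_onI, rule ccontr)
  fix e e' assume e: "e \<in> E" "e' \<in> E" "e +o W = e' +o W" "e \<noteq> e'"
  have *: "(\<Sum>x\<in>E. mscale (if x = a then 1 else 0) x) = a" if "a \<in> E" for a
  proof -
    have "(\<Sum>x\<in>E. mscale (if x = a then 1 else 0) x) = (\<Sum>x\<in>E. if x = a then x else 0)"
      by (intro sum.cong) auto
    then show ?thesis using that E by (simp add: basis_mod_def)
  qed
  have "e - (\<Sum>x\<in>E. mscale (if x = e then 1 else 0) x) \<in> W"
    "e - (\<Sum>x\<in>E. mscale (if x = e' then 1 else 0) x) \<in> W"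
    using e W unfolding *[OF e(1)] *[OF e(2)]
    by (simp_all add: mpoly_vs.subspace_0 coset_eq_iff)
  from basis_mod_unique[OF W E this e(1)] e(4) show False by simp
qed

lemma basis_mod_coset_basis:
  assumes W: "mpoly_vs.subspace W" and E: "basis_mod W V E"
  shows "coset_basis W ((\<lambda>f. f +o W) ` V) ((\<lambda>f. f +o W) ` E)"
proof -
  let ?Q = "\<lambda>f. f +o W"
  have finE: "finite E" and inj: "inj_on ?Q E"
    using E basis_mod_inj[OF W E] by (simp_all add: basis_mod_def)
  have lin: "coset_lincomb W c (?Q ` E) = (\<Sum>e\<in>E. mscale (c (?Q e)) e) +o W" for c
  proof -
    have "coset_lincomb W c (?Q ` E) = (\<Sum>A\<in>?Q ` E. mscale (c A) (inv_into E ?Q A)) +o W"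
      by (rule coset_lincomb_eq[OF W finite_imageI[OF finE]])
        (rule f_inv_into_f[of _ ?Q E, symmetric])
    also have "(\<Sum>A\<in>?Q ` E. mscale (c A) (inv_into E ?Q A)) = (\<Sum>e\<in>E. mscale (c (?Q e)) e)"
      by (simp add: sum.reindex[OF inj] inv_into_f_f[OF inj])
    finally show ?thesis .
  qed
  have "\<exists>!c. (\<forall>C. C \<notin> ?Q ` E \<longrightarrow> c C = 0) \<and> v +o W = coset_lincomb W c (?Q ` E)" if "v \<in> V" for v
  proof (rule ex_ex1I)
    obtain c where c: "v - (\<Sum>e\<in>E. mscale (c e) e) \<in> W"
      using basis_mod_spanD[OF E \<open>v \<in> V\<close>] by (elim exE)
    \<comment> \<open>Coefficients are carried over to cosets and set to 0 elsewhere, since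
      \<open>coset_basis\<close> asks for uniqueness only among functions that vanish off the
      basis.\<close>
    define c' where "c' C = (if C \<in> ?Q ` E then c (inv_into E ?Q C) else 0)" for C
    have "(\<Sum>e\<in>E. mscale (c' (?Q e)) e) = (\<Sum>e\<in>E. mscale (c e) e)"
      by (intro sum.cong) (auto simp: c'_def inv_into_f_f[OF inj])
    then have "v +o W = coset_lincomb W c' (?Q ` E)"
      using c by (simp add: lin coset_eq_iff[OF W])
    moreover have "\<forall>C. C \<notin> ?Q ` E \<longrightarrow> c' C = 0" by (simp add: c'_def)
    ultimately show "\<exists>c. (\<forall>C. C \<notin> ?Q ` E \<longrightarrow> c C = 0) \<and> v +o W = coset_lincomb W c (?Q ` E)"
      by blast
  next
    fix c c'
    assume c: "(\<forall>C. C \<notin> ?Q ` E \<longrightarrow> c C = 0) \<and> v +o W = coset_lincomb W c (?Q ` E)"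
      and c': "(\<forall>C. C \<notin> ?Q ` E \<longrightarrow> c' C = 0) \<and> v +o W = coset_lincomb W c' (?Q ` E)"
    have 1: "v - (\<Sum>e\<in>E. mscale (c (?Q e)) e) \<in> W"
      using c by (simp only: lin coset_eq_iff[OF W])
    have 2: "v - (\<Sum>e\<in>E. mscale (c' (?Q e)) e) \<in> W"
      using c' by (simp only: lin coset_eq_iff[OF W])
    from basis_mod_unique[OF W E 1 2] have "c (?Q e) = c' (?Q e)" if "e \<in> E" for e
      using that .
    note eq = this
    show "c = c'"
    proof
      fix C
      show "c C = c' C"
      proof (cases "C \<in> ?Q ` E")
        case True
        then obtain e where "e \<in> E" "C = ?Q e" by (elim imageE)
        with eq[of e] show ?thesis by simp
      next
        case False
        then show ?thesis using c c' by simp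
      qed
    qed
  qed
  note ex1 = this
  have "E \<subseteq> V" using E by (simp add: basis_mod_def)
  show ?thesis
    unfolding coset_basis_def
  proof (intro conjI finite_imageI image_mono ballI)
    fix A assume "A \<in> ?Q ` V"
    then obtain v where "v \<in> V" "A = ?Q v" by (elim imageE)
    with ex1[of v] show "\<exists>!c. (\<forall>C. C \<notin> ?Q ` E \<longrightarrow> c C = 0) \<and> A = coset_lincomb W c (?Q ` E)"
      by (simp only:)
  qed fact+
qed

lemma card_finsupp_functions:
  assumes "finite B"
  shows "card {c :: 'a \<Rightarrow> 'k::{finite, zero}. \<forall>C. C \<notin> B \<longrightarrow> c C = 0} = CARD('k) ^ card B"
proof -
  have "bij_betw (\<lambda>c. restrict c B) {c :: 'a \<Rightarrow> 'k. \<forall>C. C \<notin> B \<longrightarrow> c C = 0} (PiE B (\<lambda>_. UNIV))"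
    by (rule bij_betw_byWitness[where f' = "\<lambda>c C. if C \<in> B then c C else 0"])
      (auto simp: fun_eq_iff PiE_def extensional_def)
  then have "card {c :: 'a \<Rightarrow> 'k. \<forall>C. C \<notin> B \<longrightarrow> c C = 0} = card (PiE B (\<lambda>_. UNIV :: 'k set))"
    by (rule bij_betw_same_card)
  then show ?thesis using assms by (simp add: card_PiE)
qed

text \<open>Coordinates identify the space with the coefficient functions on \<open>B\<close>. As
  this holds for every basis, all bases have the same size and the choice made in
  \<open>coset_dim\<close> does not matter.\<close>

lemma coset_basis_card:
  fixes W :: "('n, 'k::{field, finite}) mpoly set"
  assumes W: "mpoly_vs.subspace W" and V: "mpoly_vs.subspace V"
    and B: "coset_basis W ((\<lambda>f. f +o W) ` V) B"
  shows "card ((\<lambda>f. f +o W) ` V) = CARD('k) ^ card B"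
proof -
  let ?F = "{c :: ('n, 'k) mpoly set \<Rightarrow> 'k. \<forall>C. C \<notin> B \<longrightarrow> c C = 0}"
  let ?U = "(\<lambda>f. f +o W) ` V"
  have fin: "finite B" and sub: "B \<subseteq> ?U"
    and "\<forall>A\<in>?U. \<exists>!c. (\<forall>C. C \<notin> B \<longrightarrow> c C = 0) \<and> A = coset_lincomb W c B"
    using B unfolding coset_basis_def by - (elim conjE, assumption)+
  note ex = bspec[OF this(3)]
  define r where "r = inv_into V (\<lambda>f. f +o W)"
  have r: "r A \<in> V" "A = r A +o W" if "A \<in> B" for A
    using subsetD[OF sub that] unfolding r_def
    by (rule inv_into_into, rule f_inv_into_f[symmetric])
  have mem: "coset_lincomb W c B \<in> ?U" for c
  proof -
    have "coset_lincomb W c B = (\<Sum>A\<in>B. mscale (c A) (r A)) +o W"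
      by (rule coset_lincomb_eq[OF W fin r(2)])
    moreover have "(\<Sum>A\<in>B. mscale (c A) (r A)) \<in> V"
      by (intro mpoly_vs.subspace_sum[OF V] mpoly_vs.subspace_scale[OF V] r)
    ultimately show ?thesis by (rule image_eqI)
  qed
  have "bij_betw (\<lambda>c. coset_lincomb W c B) ?F ?U"
    unfolding bij_betw_def
  proof
    show "inj_on (\<lambda>c. coset_lincomb W c B) ?F"
    proof (rule inj_onI)
      fix c c' assume c: "c \<in> ?F" "c' \<in> ?F" "coset_lincomb W c B = coset_lincomb W c' B"
      from ex[OF mem[of c]] obtain z
        where z: "\<forall>y. (\<forall>C. C \<notin> B \<longrightarrow> y C = 0) \<and> coset_lincomb W c B = coset_lincomb W y B \<longrightarrow> y = z"
        by (elim ex1E)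
      have "c = z" by (rule z[rule_format]) (intro conjI refl CollectD[OF c(1)])
      moreover have "c' = z" by (rule z[rule_format]) (intro conjI c(3) CollectD[OF c(2)])
      ultimately show "c = c'" by (simp only:)
    qed
    show "(\<lambda>c. coset_lincomb W c B) ` ?F = ?U"
    proof
      show "?U \<subseteq> (\<lambda>c. coset_lincomb W c B) ` ?F"
      proof
        fix A assume "A \<in> ?U"
        from ex1_implies_ex[OF ex[OF this]]
        obtain c where "\<forall>C. C \<notin> B \<longrightarrow> c C = 0" "A = coset_lincomb W c B" by (elim exE conjE)
        then show "A \<in> (\<lambda>c. coset_lincomb W c B) ` ?F" by (intro image_eqI[of _ _ c] CollectI)
      qed
    qed (rule image_subsetI, rule mem)
  qed
  from bij_betw_same_card[OF this] show ?thesis by (simp add: card_finsupp_functions[OF fin])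
qed

lemma coset_dim_card:
  fixes W :: "('n, 'k::{field, finite}) mpoly set"
  assumes W: "mpoly_vs.subspace W" and V: "mpoly_vs.subspace V" and fin: "finite V"
  shows "card ((\<lambda>f. f +o W) ` V) = CARD('k) ^ coset_dim W ((\<lambda>f. f +o W) ` V)"
proof -
  have "\<exists>B. coset_basis W ((\<lambda>f. f +o W) ` V) B"
    using ex_basis_mod[OF W fin] by (elim exE) (rule exI, rule basis_mod_coset_basis[OF W])
  then have "coset_basis W ((\<lambda>f. f +o W) ` V) (SOME B. coset_basis W ((\<lambda>f. f +o W) ` V) B)"
    by (rule someI_ex)
  from coset_basis_card[OF W V this] show ?thesis unfolding coset_dim_def .
qed

lemma coset_dim_eqI:
  fixes W :: "('n, 'k::{field, finite}) mpoly set"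
  assumes "mpoly_vs.subspace W" "mpoly_vs.subspace V" "finite V"
    and "card ((\<lambda>f. f +o W) ` V) = CARD('k) ^ k"
  shows "coset_dim W ((\<lambda>f. f +o W) ` V) = k"
proof -
  have "1 < CARD('k)"
    using card_mono[of UNIV "{0, 1 :: 'k}"] by simp
  moreover have "CARD('k) ^ coset_dim W ((\<lambda>f. f +o W) ` V) = CARD('k) ^ k"
    using coset_dim_card[OF assms(1-3)] assms(4) by simp
  ultimately show ?thesis using power_inject_exp by blast
qed

section \<open>Duality\<close>

lemma subspace_homogeneous_part: "mpoly_vs.subspace (homogeneous_part d)"
  by (simp add: mpoly_vs.subspace_def homogeneous_0 homogeneous_add homogeneous_mscale)

text \<open>For \<open>W\<close> stable under a group \<open>G\<close>, these are the
  representatives of degree \<open>d\<close> of the fixed cosets.\<close>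

definition fixed_forms ::
  "('k::field ^ 'n::finite ^ 'n::finite) set \<Rightarrow> ('n::finite, 'k) mpoly set \<Rightarrow> nat \<Rightarrow> ('n, 'k) mpoly set" where
  "fixed_forms G W d = {f \<in> homogeneous_part d. \<forall>g\<in>G. subst_act g f - f \<in> W}"

lemma subspace_fixed_forms:
  fixes W :: "('n::finite, 'k::field) mpoly set"
  assumes W: "mpoly_vs.subspace W"
  shows "mpoly_vs.subspace (fixed_forms G W d)"
proof -
  have add: "subst_act g (x + y) - (x + y) = (subst_act g x - x) + (subst_act g y - y)"
    for g and x y :: "('n, 'k) mpoly"
    by (simp add: subst_act_add)
  have scale: "subst_act g (mscale c x) - mscale c x = mscale c (subst_act g x - x)"
    for g c and x :: "('n, 'k) mpoly"
    by (simp add: subst_act_mscale mpoly_vs.scale_right_diff_distrib)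
  show ?thesis
  proof (rule mpoly_vs.subspaceI)
    show "0 \<in> fixed_forms G W d"
      by (simp add: fixed_forms_def homogeneous_0 subst_act_0 mpoly_vs.subspace_0[OF W])
    show "x + y \<in> fixed_forms G W d" if "x \<in> fixed_forms G W d" "y \<in> fixed_forms G W d" for x y
      using that mpoly_vs.subspace_add[OF W] unfolding fixed_forms_def mem_Collect_eq add
      by (simp add: homogeneous_add)
    show "mscale c x \<in> fixed_forms G W d" if "x \<in> fixed_forms G W d" for c x
      using that mpoly_vs.subspace_scale[OF W] unfolding fixed_forms_def mem_Collect_eq scale
      by (simp add: homogeneous_mscale)
  qed
qed

lemma subst_act_inverse:
  assumes "invertible g"
  obtains h where "\<And>f. subst_act g (subst_act h f) = f" "\<And>f. subst_act h (subst_act g f) = f"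
proof -
  obtain h where "g ** h = mat 1" "h ** g = mat 1"
    using assms by (auto simp: invertible_def)
  then show ?thesis
    by (intro that[of h]) (simp_all add: subst_act_mat_1 flip: subst_act_matrix_mult)
qed

text \<open>The image of a coset is a whole coset only because the ideal is also stable under the
  inverse of \<open>g\<close>; this supplies the inclusion of the coset in its image.\<close>

lemma subst_act_coset_eq_iff:
  fixes f :: "('n::finite, 'k::{field, finite}) mpoly"
  assumes r: "r = CARD('k) ^ m" and g: "invertible g"
  shows "subst_act g ` (f +o frobenius_power r) = f +o frobenius_power r
     \<longleftrightarrow> subst_act g f - f \<in> frobenius_power r" (is "?L \<longleftrightarrow> ?R")
proof
  have mem: "u \<in> f +o frobenius_power r \<longleftrightarrow> u - f \<in> frobenius_power r" for u
    unfolding elt_set_plus_def by (auto intro!: bexI[of _ "u - f"])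
  {
    assume ?L
    have "f \<in> f +o frobenius_power r" by (simp add: mem frobenius_power_0)
    with \<open>?L\<close> have "subst_act g f \<in> f +o frobenius_power r" by blast
    then show ?R by (simp add: mem)
  }
  assume R: ?R
  obtain h where h: "\<And>f. subst_act g (subst_act h f) = f" "\<And>f. subst_act h (subst_act g f) = f"
    using subst_act_inverse[OF g] by metis
  have stable: "subst_act g' w \<in> frobenius_power r" if "w \<in> frobenius_power r" for g' and w :: "('n, 'k) mpoly"
    using subst_act_frobenius_power that by (simp add: r)
  show ?L
  proof
    show "subst_act g ` (f +o frobenius_power r) \<subseteq> f +o frobenius_power r"
    proof
      fix u assume "u \<in> subst_act g ` (f +o frobenius_power r)"
      then obtain v where v: "u = subst_act g v" "v - f \<in> frobenius_power r" by (auto simp: mem)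
      then have "(subst_act g f - f) + subst_act g (v - f) \<in> frobenius_power r"
        using R stable frobenius_power_add by blast
      then show "u \<in> f +o frobenius_power r" by (simp add: mem v subst_act_diff)
    qed
    show "f +o frobenius_power r \<subseteq> subst_act g ` (f +o frobenius_power r)"
    proof
      fix u assume "u \<in> f +o frobenius_power r"
      then have "(u - f) - (subst_act g f - f) \<in> frobenius_power r"
        using R frobenius_power_diff by (simp only: mem)
      then have "subst_act h (u - subst_act g f) \<in> frobenius_power r"
        by (intro stable) simp
      then have "subst_act h u \<in> f +o frobenius_power r"
        by (simp add: mem subst_act_diff h)
      then show "u \<in> subst_act g ` (f +o frobenius_power r)"
        by (rule rev_image_eqI) (simp add: h)
    qed
  qed
qed

lemma fixed_space_homogeneous:
  fixes G :: "('k::{field, finite} ^ 'n::finite ^ 'n::finite) set"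
  assumes r: "r = CARD('k) ^ m" and G: "\<forall>g\<in>G. invertible g"
  shows "fixed_space G (frobenius_power r) \<inter> (\<lambda>f. f +o frobenius_power r) ` homogeneous_part d
    = (\<lambda>f. f +o frobenius_power r) ` fixed_forms G (frobenius_power r) d"
proof -
  have "f +o frobenius_power r \<in> fixed_space G (frobenius_power r) \<longleftrightarrow>
      (\<forall>g\<in>G. subst_act g f - f \<in> frobenius_power r)" for f
  proof -
    have "(\<forall>g\<in>G. subst_act g ` (f +o frobenius_power r) = f +o frobenius_power r) \<longleftrightarrow>
        (\<forall>g\<in>G. subst_act g f - f \<in> frobenius_power r)"
      by (rule ball_cong[OF refl], rule subst_act_coset_eq_iff[OF r bspec[OF G]])
    then show ?thesis by (simp add: fixed_space_def quotient_space_def)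
  qed
  then show ?thesis unfolding fixed_forms_def by blast
qed

text \<open>Nondegeneracy on the side of degree D - d. Multiplying by the complementary monomial
  moves the coefficient of \<open>f\<close> at \<open>e\<close> to the socle, so orthogonality kills
  every coefficient at an exponent outside the ideal.\<close>

lemma homogeneous_orthogonal_frobenius_power:
  fixes f :: "('n::finite, 'k::comm_ring_1) mpoly"
  assumes f: "f \<in> homogeneous_part (CARD('n) * (r - 1) - d)" and d: "d \<le> CARD('n) * (r - 1)"
    and orth: "\<And>u. u \<in> homogeneous_part d \<Longrightarrow> top_coeff r (f * u) = 0"
  shows "f \<in> frobenius_power r"
  unfolding frobenius_power_iff
proof (rule ballI, rule ccontr)
  fix e assume e: "e \<in> Poly_Mapping.keys f" and ne: "\<nexists>i. r \<le> Poly_Mapping.lookup e i"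
  then have le: "Poly_Mapping.lookup e i \<le> r - 1" for i
  proof -
    have "\<not> r \<le> Poly_Mapping.lookup e i" using ne by blast
    then show ?thesis by linarith
  qed
  \<comment> \<open>The truncated subtraction is exact here, as no entry of \<open>e\<close> exceeds
    \<open>r - 1\<close>.\<close>
  let ?u = "Poly_Mapping.single (const_exponent (r - 1) - e) (1 :: 'k)"
  have deg: "(\<Sum>i\<in>UNIV. Poly_Mapping.lookup e i) = CARD('n) * (r - 1) - d"
    using f e by (simp add: homogeneous_part_def)
  have "(\<Sum>i\<in>UNIV. Poly_Mapping.lookup (const_exponent (r - 1) - e) i) =
      (\<Sum>i\<in>(UNIV :: 'n set). r - 1) - (\<Sum>i\<in>UNIV. Poly_Mapping.lookup e i)"
    by (simp only: lookup_minus lookup_const_exponent) (rule sum_subtractf_nat, use le in simp)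
  also have "\<dots> = d" using deg d by simp
  finally have "?u \<in> homogeneous_part d" by (intro homogeneous_single) simp
  moreover have "top_coeff r (f * ?u) = Poly_Mapping.lookup f e"
  proof -
    have "top_coeff r (f * ?u) = (\<Sum>e'\<in>Poly_Mapping.keys f.
        top_coeff r (Poly_Mapping.single e' (Poly_Mapping.lookup f e') * ?u))"
      by (subst poly_mapping_sum_single[of f, symmetric]) (simp only: sum_distrib_right top_coeff_sum)
    also have "\<dots> = (\<Sum>e'\<in>Poly_Mapping.keys f. if e' = e then Poly_Mapping.lookup f e' else 0)"
    proof (intro sum.cong refl)
      fix e'
      have "e' + (const_exponent (r - 1) - e) = const_exponent (r - 1) \<longleftrightarrow> e' = e"
      proof -
        have "e + (const_exponent (r - 1) - e) = const_exponent (r - 1)"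
        proof (rule poly_mapping_eqI)
          fix i
          show "Poly_Mapping.lookup (e + (const_exponent (r - 1) - e)) i = Poly_Mapping.lookup (const_exponent (r - 1)) i"
            using le[of i] by (simp add: lookup_add lookup_minus)
        qed
        then show ?thesis by (metis add_right_cancel)
      qed
      then show "top_coeff r (Poly_Mapping.single e' (Poly_Mapping.lookup f e') * ?u) =
          (if e' = e then Poly_Mapping.lookup f e' else 0)"
        by (simp add: mult_single top_coeff_def lookup_single when_def)
    qed
    also have "\<dots> = Poly_Mapping.lookup f e" using e by simp
    finally show ?thesis .
  qed
  ultimately show False using orth e by (simp add: in_keys_iff)
qed

lemma subspace_cofixed_kernel: "mpoly_vs.subspace (cofixed_kernel G)"
  unfolding cofixed_kernel_def by (rule mpoly_vs.subspace_span)

text \<open>Modulo the ideal, f equals gf. Hence \<tau>(f gu) = \<tau>(gf gu) = \<tau>(g(fu)) =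
  \<tau>(fu), and f is orthogonal to gu - u.\<close>

lemma fixed_forms_orthogonal_cofixed_kernel:
  fixes f :: "('n::finite, 'k::{field, finite}) mpoly"
  assumes r: "r = CARD('k) ^ m" and G: "\<forall>g\<in>G. invertible g"
    and f: "f \<in> fixed_forms G (frobenius_power r) d" and w: "w \<in> cofixed_kernel G"
  shows "top_coeff r (f * w) = 0"
  using w unfolding cofixed_kernel_def
proof (induction rule: mpoly_vs.span_induct_alt)
  case base
  show ?case by (simp add: top_coeff_0)
next
  case (step c x y)
  then obtain g u where g: "g \<in> G" and x: "x = subst_act g u - u" by blast
  have "u' * f \<in> frobenius_power r" if "f \<in> frobenius_power r" for f u' :: "('n, 'k) mpoly"
    using that by (rule frobenius_power_mult)
  then have "subst_act g u * (subst_act g f - f) \<in> frobenius_power r"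
    using f g by (simp add: fixed_forms_def)
  then have "top_coeff r (subst_act g u * (subst_act g f - f)) = 0"
    by (rule top_coeff_frobenius_power) (simp add: r)
  then have "top_coeff r (f * subst_act g u) = top_coeff r (subst_act g (f * u))"
    by (simp add: right_diff_distrib top_coeff_diff subst_act_mult mult.commute)
  also have "\<dots> = top_coeff r (f * u)"
    using bspec[OF G g] by (rule top_coeff_subst_act[OF r])
  finally have "top_coeff r (f * x) = 0"
    by (simp add: x right_diff_distrib top_coeff_diff)
  moreover have "f * (mscale c x + y) = mscale c (f * x) + f * y"
    by (simp add: mscale_def distrib_left mult.left_commute)
  ultimately show ?case using step.IH by (simp add: top_coeff_add top_coeff_mscale)
qed

text \<open>For u = gv, invariance of \<tau> gives \<tau>((gf - f) u) = \<tau>(fv) - \<tau>(f gv) =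
  -\<tau>(f (gv - v)) = 0. Every form u of degree d arises in this way, so nondegeneracy puts gf - f
  into the ideal.\<close>

lemma orthogonal_cofixed_kernel_fixed_forms:
  fixes f :: "('n::finite, 'k::{field, finite}) mpoly"
  assumes r: "r = CARD('k) ^ m" and G: "\<forall>g\<in>G. invertible g"
    and f: "f \<in> homogeneous_part (CARD('n) * (r - 1) - d)" and d: "d \<le> CARD('n) * (r - 1)"
    and orth: "\<And>w. w \<in> cofixed_kernel G \<Longrightarrow> w \<in> homogeneous_part d \<Longrightarrow> top_coeff r (f * w) = 0"
  shows "f \<in> fixed_forms G (frobenius_power r) (CARD('n) * (r - 1) - d)"
  unfolding fixed_forms_def
proof (intro CollectI conjI f ballI)
  fix g assume g: "g \<in> G"
  show "subst_act g f - f \<in> frobenius_power r"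
  proof (rule homogeneous_orthogonal_frobenius_power)
    show "subst_act g f - f \<in> homogeneous_part (CARD('n) * (r - 1) - d)"
      by (intro homogeneous_diff homogeneous_subst_act f)
    fix u :: "('n, 'k) mpoly" assume u: "u \<in> homogeneous_part d"
    obtain h where h: "\<And>f. subst_act g (subst_act h f) = f"
      using subst_act_inverse[OF bspec[OF G g]] by metis
    define v where "v = subst_act h u"
    have v: "v \<in> homogeneous_part d" "u = subst_act g v"
      using homogeneous_subst_act[OF u] by (simp_all add: v_def h)
    have "subst_act g v - v \<in> cofixed_kernel G"
      unfolding cofixed_kernel_def by (rule mpoly_vs.span_base) (use g in blast)
    moreover have "subst_act g v - v \<in> homogeneous_part d"
      by (intro homogeneous_diff homogeneous_subst_act v)
    ultimately have "top_coeff r (f * (subst_act g v - v)) = 0" by (rule orth)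
    moreover have "top_coeff r (subst_act g (f * v)) = top_coeff r (f * v)"
      using bspec[OF G g] by (rule top_coeff_subst_act[OF r])
    ultimately show "top_coeff r ((subst_act g f - f) * u) = 0"
      by (simp add: v(2) subst_act_mult left_diff_distrib right_diff_distrib top_coeff_diff)
  qed (rule d)
qed

text \<open>The other half of perfectness; \<open>L\<close> prescribes a linear functional by its
  values on monomials. For \<open>d \<le> r - 1\<close> every monomial of degree \<open>d\<close>
  divides the socle monomial, and the complements weighted by \<open>L\<close> represent the
  functional.\<close>

lemma ex_dual_form:
  fixes L :: "('n::finite \<Rightarrow>\<^sub>0 nat) \<Rightarrow> 'k::comm_ring_1"
  assumes d: "d \<le> r - 1"
  obtains f where "f \<in> homogeneous_part (CARD('n) * (r - 1) - d)"
    "\<And>u. u \<in> homogeneous_part d \<Longrightarrow>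
      top_coeff r (f * u) = (\<Sum>b\<in>Poly_Mapping.keys u. Poly_Mapping.lookup u b * L b)"
proof -
  define X where "X = {e :: 'n \<Rightarrow>\<^sub>0 nat. (\<Sum>i\<in>UNIV. Poly_Mapping.lookup e i) = d}"
  have finX: "finite X" unfolding X_def by (rule finite_exponents)
  have le: "Poly_Mapping.lookup a i \<le> r - 1" if "a \<in> X" for a i
  proof -
    have "Poly_Mapping.lookup a i \<le> sum (Poly_Mapping.lookup a) UNIV"
      by (rule member_le_sum) auto
    then show ?thesis using that d by (simp add: X_def)
  qed
  define f where "f = (\<Sum>a\<in>X. Poly_Mapping.single (const_exponent (r - 1) - a) (L a))"
  have "f \<in> homogeneous_part (CARD('n) * (r - 1) - d)"
    unfolding f_def
  proof (intro homogeneous_sum homogeneous_single disjI2)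
    fix a assume a: "a \<in> X"
    have "(\<Sum>i\<in>UNIV. Poly_Mapping.lookup (const_exponent (r - 1) - a) i) =
        (\<Sum>i\<in>(UNIV :: 'n set). r - 1) - (\<Sum>i\<in>UNIV. Poly_Mapping.lookup a i)"
      by (simp only: lookup_minus lookup_const_exponent) (rule sum_subtractf_nat, use le a in simp)
    then show "(\<Sum>i\<in>UNIV. Poly_Mapping.lookup (const_exponent (r - 1) - a) i) = CARD('n) * (r - 1) - d"
      using a by (simp add: X_def)
  qed
  moreover have "top_coeff r (f * u) = (\<Sum>b\<in>Poly_Mapping.keys u. Poly_Mapping.lookup u b * L b)"
    if u: "u \<in> homogeneous_part d" for u
  proof -
    have "top_coeff r (f * Poly_Mapping.single b c) = c * L b" if b: "b \<in> X" for b c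
    proof -
      have "top_coeff r (f * Poly_Mapping.single b c) = (\<Sum>a\<in>X. if a = b then c * L a else 0)"
        unfolding f_def sum_distrib_right top_coeff_sum
      proof (intro sum.cong refl)
        fix a assume a: "a \<in> X"
        have "const_exponent (r - 1) - a + b = const_exponent (r - 1) \<longleftrightarrow> a = b"
        proof -
          have "const_exponent (r - 1) - a + a = const_exponent (r - 1)"
          proof (rule poly_mapping_eqI)
            fix i
            show "Poly_Mapping.lookup (const_exponent (r - 1) - a + a) i = Poly_Mapping.lookup (const_exponent (r - 1)) i"
              using le[OF a, of i] by (simp add: lookup_add lookup_minus)
          qed
          then show ?thesis by (metis add_left_cancel)
        qed
        then show "top_coeff r (Poly_Mapping.single (const_exponent (r - 1) - a) (L a) * Poly_Mapping.single b c)
            = (if a = b then c * L a else 0)"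
          unfolding mult_single top_coeff_def lookup_single when_def by (simp only: mult.commute)
      qed
      then show ?thesis using b finX by simp
    qed
    moreover have "b \<in> X" if "b \<in> Poly_Mapping.keys u" for b
      using u that by (simp add: homogeneous_part_def X_def)
    moreover have "top_coeff r (f * u) =
        (\<Sum>b\<in>Poly_Mapping.keys u. top_coeff r (f * Poly_Mapping.single b (Poly_Mapping.lookup u b)))"
      by (subst poly_mapping_sum_single[of u, symmetric]) (simp only: sum_distrib_left top_coeff_sum)
    ultimately show ?thesis by simp
  qed
  ultimately show ?thesis by (rule that)
qed

lemma card_image_cong_kernel:
  assumes "\<And>x y. x \<in> A \<Longrightarrow> y \<in> A \<Longrightarrow> f x = f y \<longleftrightarrow> g x = g y"
  shows "card (f ` A) = card (g ` A)"
proof (rule bij_betw_same_card)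
  define h where "h z = g (inv_into A f z)" for z
  have h: "h (f x) = g x" if "x \<in> A" for x
    using assms[of "inv_into A f (f x)" x] that
    by (simp add: h_def inv_into_into f_inv_into_f)
  show "bij_betw h (f ` A) (g ` A)"
    unfolding bij_betw_def inj_on_def using h assms by (auto simp: image_iff)
qed

text \<open>Pair the fixed forms with a basis \<open>E\<close> of the cofixed space in degree
  \<open>d\<close>. The values on \<open>E\<close> determine exactly the coset of the form, and
  every choice of values occurs, so both sides have \<open>CARD('k) ^ card E\<close>
  elements.\<close>

lemma card_fixed_forms_cosets:
  fixes G :: "('k::{field, finite} ^ 'n::finite ^ 'n::finite) set"
  assumes r: "r = CARD('k) ^ m" and G: "\<forall>g\<in>G. invertible g" and d: "d \<le> r - 1"
  shows "card ((\<lambda>f. f +o frobenius_power r) ` fixed_forms G (frobenius_power r) (CARD('n) * (r - 1) - d))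
    = card ((\<lambda>f. f +o cofixed_kernel G) ` homogeneous_part d)"
proof -
  let ?M = "frobenius_power r :: ('n, 'k) mpoly set"
  let ?N = "cofixed_kernel G"
  let ?V = "fixed_forms G ?M (CARD('n) * (r - 1) - d)"
  have dD: "d \<le> CARD('n) * (r - 1)"
  proof -
    have "1 * (r - 1) \<le> CARD('n) * (r - 1)"
      by (intro mult_right_mono) (simp_all add: Suc_le_eq)
    then show ?thesis using d by linarith
  qed
  obtain E where E: "basis_mod ?N (homogeneous_part d) E"
    using ex_basis_mod[OF subspace_cofixed_kernel finite_homogeneous_part] by blast
  have finE: "finite E" and Ehom: "\<And>e. e \<in> E \<Longrightarrow> e \<in> homogeneous_part d"
    using E by (auto simp: basis_mod_def)
  define \<Psi> where "\<Psi> f = restrict (\<lambda>e. top_coeff r (f * e)) E" for f :: "('n, 'k) mpoly"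
  have pair: "top_coeff r (f * u) = (\<Sum>e\<in>E. c e * top_coeff r (f * e))"
    if "f \<in> ?V" "u - (\<Sum>e\<in>E. mscale (c e) e) \<in> ?N" for f u c
  proof -
    have "top_coeff r (f * (u - (\<Sum>e\<in>E. mscale (c e) e))) = 0"
      by (rule fixed_forms_orthogonal_cofixed_kernel[OF r G that])
    moreover have "f * mscale (c e) e = mscale (c e) (f * e)" for e
      by (simp add: mscale_def mult.left_commute)
    ultimately show ?thesis
      by (simp add: right_diff_distrib top_coeff_diff sum_distrib_left top_coeff_sum top_coeff_mscale)
  qed
  have ker: "f +o ?M = h +o ?M \<longleftrightarrow> \<Psi> f = \<Psi> h" if "f \<in> ?V" "h \<in> ?V" for f h
  proof -
    have fh: "f - h \<in> ?V"
      using subspace_fixed_forms[OF subspace_frobenius_power] that by (rule mpoly_vs.subspace_diff)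
    have "\<Psi> f = \<Psi> h \<longleftrightarrow> (\<forall>e\<in>E. top_coeff r ((f - h) * e) = 0)"
    proof -
      have "\<Psi> f = \<Psi> h \<longleftrightarrow> (\<forall>e\<in>E. top_coeff r (f * e) = top_coeff r (h * e))"
      proof (intro iffI ballI)
        fix e assume "\<Psi> f = \<Psi> h" "e \<in> E"
        from fun_cong[OF this(1), of e] this(2) show "top_coeff r (f * e) = top_coeff r (h * e)"
          unfolding \<Psi>_def by (simp only: restrict_apply if_True)
      next
        assume "\<forall>e\<in>E. top_coeff r (f * e) = top_coeff r (h * e)"
        then show "\<Psi> f = \<Psi> h"
          unfolding \<Psi>_def by (intro restrict_ext) (rule bspec)
      qed
      then show ?thesis by (simp add: left_diff_distrib top_coeff_diff)
    qed
    also have "\<dots> \<longleftrightarrow> f - h \<in> ?M"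
    proof
      assume *: "\<forall>e\<in>E. top_coeff r ((f - h) * e) = 0"
      show "f - h \<in> ?M"
      proof (rule homogeneous_orthogonal_frobenius_power[OF _ dD])
        show "f - h \<in> homogeneous_part (CARD('n) * (r - 1) - d)"
          using fh by (simp add: fixed_forms_def)
        fix u :: "('n, 'k) mpoly" assume "u \<in> homogeneous_part d"
        from basis_mod_spanD[OF E this] obtain c where "u - (\<Sum>e\<in>E. mscale (c e) e) \<in> ?N"
          by (elim exE)
        from pair[OF fh this] show "top_coeff r ((f - h) * u) = 0" using * by simp
      qed
    next
      assume *: "f - h \<in> ?M"
      show "\<forall>e\<in>E. top_coeff r ((f - h) * e) = 0"
      proof
        fix e
        have "(f - h) * e \<in> ?M" using frobenius_power_mult[OF *, of e] by (simp only: mult.commute)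
        then show "top_coeff r ((f - h) * e) = 0"
          by (rule top_coeff_frobenius_power) (simp add: r)
      qed
    qed
    finally show ?thesis by (simp add: coset_eq_iff[OF subspace_frobenius_power])
  qed
  have "\<Psi> ` ?V = PiE E (\<lambda>_. UNIV)"
  proof
    show "\<Psi> ` ?V \<subseteq> PiE E (\<lambda>_. UNIV)" by (auto simp: \<Psi>_def)
    show "PiE E (\<lambda>_. UNIV) \<subseteq> \<Psi> ` ?V"
    proof
      fix \<phi> :: "('n, 'k) mpoly \<Rightarrow> 'k" assume \<phi>: "\<phi> \<in> PiE E (\<lambda>_. UNIV)"
      \<comment> \<open>\<open>C b\<close> holds the coordinates of the monomial \<open>b\<close>
        modulo the kernel. The functional that is \<open>\<phi> e\<close> on each \<open>e\<close>
        and 0 on the kernel must take the value \<open>\<Sum>e\<in>E. C b e * \<phi> e\<close> at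
        \<open>b\<close>; this is the \<open>L\<close> for which a dual form is obtained.\<close>
      define C where "C b = (SOME c. Poly_Mapping.single b 1 - (\<Sum>e\<in>E. mscale (c e) e) \<in> ?N)"
        for b :: "'n \<Rightarrow>\<^sub>0 nat"
      have C: "Poly_Mapping.single b 1 - (\<Sum>e\<in>E. mscale (C b e) e) \<in> ?N"
        if "(\<Sum>i\<in>UNIV. Poly_Mapping.lookup b i) = d" for b
      proof -
        have "Poly_Mapping.single b 1 \<in> homogeneous_part d"
          using that by (intro homogeneous_single) simp
        then have "\<exists>c. Poly_Mapping.single b 1 - (\<Sum>e\<in>E. mscale (c e) e) \<in> ?N"
          by (rule basis_mod_spanD[OF E])
        then show ?thesis unfolding C_def by (rule someI_ex)
      qed
      obtain f where f: "f \<in> homogeneous_part (CARD('n) * (r - 1) - d)"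
        and top: "\<And>u. u \<in> homogeneous_part d \<Longrightarrow>
          top_coeff r (f * u) = (\<Sum>b\<in>Poly_Mapping.keys u. Poly_Mapping.lookup u b * (\<Sum>e\<in>E. C b e * \<phi> e))"
      proof (rule ex_dual_form[OF d, of "\<lambda>b. \<Sum>e\<in>E. C b e * \<phi> e"], goal_cases)
        case (1 f)
        show ?case by (rule 1(1)[OF 1(2,3)])
      qed
      have eval: "top_coeff r (f * u) = (\<Sum>e\<in>E. c e * \<phi> e)"
        if u: "u \<in> homogeneous_part d" and c: "u - (\<Sum>e\<in>E. mscale (c e) e) \<in> ?N" for u c
      proof -
        \<comment> \<open>Coordinates of \<open>u\<close> assembled linearly from those of its
          monomials; uniqueness modulo the kernel identifies them with \<open>c\<close>.\<close>
        let ?c = "\<lambda>e. \<Sum>b\<in>Poly_Mapping.keys u. Poly_Mapping.lookup u b * C b e"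
        have "(\<Sum>b\<in>Poly_Mapping.keys u. mscale (Poly_Mapping.lookup u b)
            (Poly_Mapping.single b 1 - (\<Sum>e\<in>E. mscale (C b e) e))) \<in> ?N"
          by (intro mpoly_vs.subspace_sum[OF subspace_cofixed_kernel]
              mpoly_vs.subspace_scale[OF subspace_cofixed_kernel] C)
            (use u in \<open>simp add: homogeneous_part_def\<close>)
        also have "(\<Sum>b\<in>Poly_Mapping.keys u. mscale (Poly_Mapping.lookup u b)
            (Poly_Mapping.single b 1 - (\<Sum>e\<in>E. mscale (C b e) e))) =
          (\<Sum>b\<in>Poly_Mapping.keys u. Poly_Mapping.single b (Poly_Mapping.lookup u b)) -
          (\<Sum>b\<in>Poly_Mapping.keys u. \<Sum>e\<in>E. mscale (Poly_Mapping.lookup u b * C b e) e)"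
        proof -
          have "mscale c (Poly_Mapping.single b 1) = Poly_Mapping.single b c" for c :: 'k and b :: "'n \<Rightarrow>\<^sub>0 nat"
            by (simp add: mscale_def mconst_def mult_single)
          then show ?thesis
            by (simp add: mpoly_vs.scale_right_diff_distrib mpoly_vs.scale_sum_right sum_subtractf)
        qed
        also have "\<dots> = u - (\<Sum>e\<in>E. \<Sum>b\<in>Poly_Mapping.keys u. mscale (Poly_Mapping.lookup u b * C b e) e)"
          by (subst sum.swap) (simp add: poly_mapping_sum_single)
        also have "\<dots> = u - (\<Sum>e\<in>E. mscale (?c e) e)"
          by (simp add: mpoly_vs.scale_sum_left)
        finally have mem: "u - (\<Sum>e\<in>E. mscale (?c e) e) \<in> ?N" .
        have "c e = ?c e" if "e \<in> E" for e
          by (rule basis_mod_unique[OF subspace_cofixed_kernel E c mem that])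
        then have "(\<Sum>e\<in>E. c e * \<phi> e) = (\<Sum>e\<in>E. \<Sum>b\<in>Poly_Mapping.keys u. Poly_Mapping.lookup u b * C b e * \<phi> e)"
          by (simp add: sum_distrib_right)
        also have "\<dots> = (\<Sum>b\<in>Poly_Mapping.keys u. \<Sum>e\<in>E. Poly_Mapping.lookup u b * C b e * \<phi> e)"
          by (rule sum.swap)
        finally show ?thesis by (simp add: top[OF u] sum_distrib_left mult.assoc)
      qed
      \<comment> \<open>An element of the kernel has all coordinates 0, so the functional vanishes
        on it, and orthogonality to the kernel makes \<open>f\<close> fixed.\<close>
      have "f \<in> ?V"
      proof (rule orthogonal_cofixed_kernel_fixed_forms[OF r G f dD])
        fix w assume "w \<in> ?N" "w \<in> homogeneous_part d"
        then show "top_coeff r (f * w) = 0" using eval[of w "\<lambda>_. 0"] by simp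
      qed
      moreover have "\<Psi> f = \<phi>"
      proof
        fix e
        show "\<Psi> f e = \<phi> e"
        proof (cases "e \<in> E")
          case True
          have "(\<Sum>x\<in>E. mscale (if x = e then 1 else 0) x) = (\<Sum>x\<in>E. if x = e then x else 0)"
            by (intro sum.cong) auto
          then have "e - (\<Sum>x\<in>E. mscale (if x = e then 1 else 0) x) \<in> ?N"
            using True finE by (simp add: mpoly_vs.subspace_0[OF subspace_cofixed_kernel])
          from eval[OF Ehom[OF True] this] have "top_coeff r (f * e) = (\<Sum>x\<in>E. (if x = e then 1 else 0) * \<phi> x)" .
          also have "\<dots> = (\<Sum>x\<in>E. if x = e then \<phi> x else 0)"
            by (intro sum.cong) auto
          also have "\<dots> = \<phi> e" using True finE by simp
          finally show ?thesis using True by (simp add: \<Psi>_def)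
        next
          case False
          then show ?thesis
            unfolding \<Psi>_def by (simp only: restrict_apply if_False PiE_arb[OF \<phi> False])
        qed
      qed
      ultimately show "\<phi> \<in> \<Psi> ` ?V" by (intro image_eqI) simp_all
    qed
  qed
  then have "card ((\<lambda>f. f +o ?M) ` ?V) = CARD('k) ^ card E"
    using card_image_cong_kernel[of ?V "\<lambda>f. f +o ?M" \<Psi>] ker finE by (simp add: card_PiE)
  moreover have "card ((\<lambda>f. f +o ?N) ` homogeneous_part d) = CARD('k) ^ card E"
    using coset_basis_card[OF subspace_cofixed_kernel subspace_homogeneous_part
        basis_mod_coset_basis[OF subspace_cofixed_kernel E]]
    by (simp add: card_image basis_mod_inj[OF subspace_cofixed_kernel E])
  ultimately show ?thesis by simp
qed

section \<open>Coefficients of the Hilbert series\<close>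

lemma finite_fixed_forms: "finite (fixed_forms G W d :: ('n::finite, 'k::{field, finite}) mpoly set)"
  by (rule finite_subset[OF _ finite_homogeneous_part]) (auto simp: fixed_forms_def)

lemma hilbert_series_fixed_nth:
  fixes G :: "('k::{field, finite} ^ 'n::finite ^ 'n::finite) set"
  assumes r: "r = CARD('k) ^ m" and G: "\<forall>g\<in>G. invertible g" and d: "d \<le> r - 1"
  shows "fps_nth (hilbert_series (frobenius_power r) (fixed_space G (frobenius_power r)))
      (CARD('n) * (r - 1) - d)
    = fps_nth (hilbert_series (cofixed_kernel G) (quotient_space (cofixed_kernel G))) d"
proof -
  have "quotient_space (cofixed_kernel G) \<inter> (\<lambda>f. f +o cofixed_kernel G) ` homogeneous_part d
     = (\<lambda>f. f +o cofixed_kernel G) ` homogeneous_part d"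
    by (auto simp: quotient_space_def)
  moreover have "coset_dim (frobenius_power r)
      ((\<lambda>f. f +o frobenius_power r) ` fixed_forms G (frobenius_power r) (CARD('n) * (r - 1) - d))
    = coset_dim (cofixed_kernel G) ((\<lambda>f. f +o cofixed_kernel G) ` homogeneous_part d)"
  proof (intro coset_dim_eqI subspace_frobenius_power subspace_fixed_forms finite_fixed_forms)
    show "card ((\<lambda>f. f +o frobenius_power r) ` fixed_forms G (frobenius_power r) (CARD('n) * (r - 1) - d))
      = CARD('k) ^ coset_dim (cofixed_kernel G) ((\<lambda>f. f +o cofixed_kernel G) ` homogeneous_part d)"
      unfolding card_fixed_forms_cosets[OF r G d]
      by (rule coset_dim_card[OF subspace_cofixed_kernel subspace_homogeneous_part finite_homogeneous_part])
  qed
  ultimately show ?thesis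
    unfolding hilbert_series_def fps_nth_Abs_fps fixed_space_homogeneous[OF r G] by (simp only:)
qed

text \<open>Above the socle degree every monomial has an exponent of at least \<open>r\<close>, so
  the quotient is zero there. Through the hypothesis of the theorem this makes
  \<open>C_series\<close> a polynomial, as reflection requires.\<close>

lemma hilbert_series_fixed_nth_eq_0:
  fixes G :: "('k::{field, finite} ^ 'n::finite ^ 'n::finite) set"
  assumes r: "r = CARD('k) ^ m" and G: "\<forall>g\<in>G. invertible g" and d: "CARD('n) * (r - 1) < d"
  shows "fps_nth (hilbert_series (frobenius_power r) (fixed_space G (frobenius_power r))) d = 0"
proof -
  have sub: "f \<in> frobenius_power r" if f: "f \<in> homogeneous_part d" for f :: "('n, 'k) mpoly"
    unfolding frobenius_power_iff
  proof (rule ballI, rule ccontr)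
    fix e assume e: "e \<in> Poly_Mapping.keys f" and ne: "\<nexists>i. r \<le> Poly_Mapping.lookup e i"
    then have "Poly_Mapping.lookup e i \<le> r - 1" for i
    proof -
    have "\<not> r \<le> Poly_Mapping.lookup e i" using ne by blast
    then show ?thesis by linarith
  qed
    then have "(\<Sum>i\<in>UNIV. Poly_Mapping.lookup e i) \<le> (\<Sum>i\<in>(UNIV :: 'n set). r - 1)"
      by (rule sum_mono)
    then show False using f e d by (simp add: homogeneous_part_def)
  qed
  let ?V = "fixed_forms G (frobenius_power r) d"
  have "f +o frobenius_power r = 0 +o frobenius_power r" if "f \<in> ?V" for f
    unfolding coset_eq_iff[OF subspace_frobenius_power]
    using that sub by (simp add: fixed_forms_def)
  moreover have "0 \<in> ?V" by (rule mpoly_vs.subspace_0[OF subspace_fixed_forms[OF subspace_frobenius_power]])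
  ultimately have "(\<lambda>f. f +o frobenius_power r) ` ?V = {0 +o frobenius_power r}" by blast
  then have "card ((\<lambda>f. f +o frobenius_power r) ` ?V) = CARD('k) ^ 0" by simp
  then have "coset_dim (frobenius_power r) ((\<lambda>f. f +o frobenius_power r) ` ?V) = 0"
    by (intro coset_dim_eqI subspace_frobenius_power subspace_fixed_forms finite_fixed_forms)
  then show ?thesis by (simp add: hilbert_series_def fixed_space_homogeneous[OF r G])
qed

section \<open>Reflection of the series\<close>

text \<open>Nonzero constant coefficients make the denominators units, so they can be cleared and an
  identity of power series is equivalent to one of polynomials. One direction serves the given
  series, the other the reflected one.\<close>

lemma sum_fractions_iff:
  fixes P :: "'a::field poly" and N D :: "'i \<Rightarrow> 'a poly"
  assumes I: "finite I" and D: "\<forall>i\<in>I. coeff (D i) 0 \<noteq> 0"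
  shows "fps_of_poly P = (\<Sum>i\<in>I. fps_of_poly (N i) / fps_of_poly (D i)) \<longleftrightarrow>
    P * (\<Prod>i\<in>I. D i) = (\<Sum>i\<in>I. N i * (\<Prod>k\<in>I-{i}. D k))"
proof -
  let ?T = "fps_of_poly (\<Prod>i\<in>I. D i)"
  have sum: "(\<Sum>i\<in>I. fps_of_poly (N i) / fps_of_poly (D i)) * ?T =
      (\<Sum>i\<in>I. fps_of_poly (N i * (\<Prod>k\<in>I-{i}. D k)))"
    unfolding sum_distrib_right
  proof (intro sum.cong refl)
    fix i assume i: "i \<in> I"
    have nz: "fps_nth (fps_of_poly (D i)) 0 \<noteq> 0" using bspec[OF D i] by simp
    have "?T = fps_of_poly (D i) * fps_of_poly (\<Prod>k\<in>I-{i}. D k)"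
      by (simp add: prod.remove[OF I i] flip: fps_of_poly_mult)
    then have "fps_of_poly (N i) / fps_of_poly (D i) * ?T =
        fps_of_poly (N i) * (inverse (fps_of_poly (D i)) * fps_of_poly (D i)) * fps_of_poly (\<Prod>k\<in>I-{i}. D k)"
      by (simp only: fps_divide_unit[OF nz] mult.assoc)
    then show "fps_of_poly (N i) / fps_of_poly (D i) * ?T = fps_of_poly (N i * (\<Prod>k\<in>I-{i}. D k))"
      by (simp only: inverse_mult_eq_1[OF nz] mult_1_right fps_of_poly_mult)
  qed
  have T: "?T \<noteq> 0"
  proof -
    have "poly (\<Prod>i\<in>I. D i) 0 \<noteq> 0" unfolding poly_prod using I D by (simp add: poly_0_coeff_0)
    then have "coeff (\<Prod>i\<in>I. D i) 0 \<noteq> 0" unfolding poly_0_coeff_0 .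
    then show ?thesis by (metis fps_of_poly_nth fps_zero_nth)
  qed
  have "fps_of_poly P = (\<Sum>i\<in>I. fps_of_poly (N i) / fps_of_poly (D i)) \<longleftrightarrow>
      fps_of_poly P * ?T = (\<Sum>i\<in>I. fps_of_poly (N i * (\<Prod>k\<in>I-{i}. D k)))"
    unfolding sum[symmetric] by (rule mult_right_cancel[OF T, symmetric])
  also have "\<dots> \<longleftrightarrow> P * (\<Prod>i\<in>I. D i) = (\<Sum>i\<in>I. N i * (\<Prod>k\<in>I-{i}. D k))"
    by (simp only: fps_of_poly_eq_iff flip: fps_of_poly_mult fps_of_poly_sum)
  finally show ?thesis .
qed

text \<open>The right side is the cleared identity of \<open>sum_fractions_iff\<close> at the point
  \<open>x\<close>. The two lemmas together lead from power series to values of rational functions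
  and back.\<close>

lemma sum_fractions_eval_iff:
  fixes P :: "'a::field poly" and N D :: "'i \<Rightarrow> 'a poly"
  assumes I: "finite I" and D: "\<forall>i\<in>I. poly (D i) x \<noteq> 0"
  shows "poly P x = (\<Sum>i\<in>I. poly (N i) x / poly (D i) x) \<longleftrightarrow>
    poly (P * (\<Prod>i\<in>I. D i)) x = poly (\<Sum>i\<in>I. N i * (\<Prod>k\<in>I-{i}. D k)) x"
proof -
  let ?T = "poly (\<Prod>i\<in>I. D i) x"
  have sum: "(\<Sum>i\<in>I. poly (N i) x / poly (D i) x) * ?T = poly (\<Sum>i\<in>I. N i * (\<Prod>k\<in>I-{i}. D k)) x"
    unfolding sum_distrib_right poly_sum
  proof (intro sum.cong refl)
    fix i assume i: "i \<in> I"
    show "poly (N i) x / poly (D i) x * ?T = poly (N i * (\<Prod>k\<in>I-{i}. D k)) x"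
      using bspec[OF D i] by (simp add: prod.remove[OF I i])
  qed
  have T: "?T \<noteq> 0" using I D by (simp add: poly_prod)
  show ?thesis
    unfolding sum[symmetric] poly_mult by (rule mult_right_cancel[OF T, symmetric])
qed

text \<open>
  There is no substitution of \<open>1/t\<close> into a formal power series, so both sides are compared as
  rational functions by their values at rational \<open>x > 1\<close>.
\<close>

lemma reflected_sum_fractions:
  fixes P :: "rat poly" and N D N' D' :: "'i \<Rightarrow> rat poly"
  assumes I: "finite I" and deg: "degree P \<le> n"
    and D0: "\<forall>i\<in>I. coeff (D i) 0 \<noteq> 0" "\<forall>i\<in>I. coeff (D' i) 0 \<noteq> 0"
    and D: "\<And>x. 1 < x \<Longrightarrow> \<forall>i\<in>I. poly (D i) (1 / x) \<noteq> 0"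
      "\<And>x. 1 < x \<Longrightarrow> \<forall>i\<in>I. poly (D' i) x \<noteq> 0"
    and eq: "\<And>i x. i \<in> I \<Longrightarrow> 1 < x \<Longrightarrow>
      x ^ n * (poly (N i) (1 / x) / poly (D i) (1 / x)) = poly (N' i) x / poly (D' i) x"
    and P: "fps_of_poly P = (\<Sum>i\<in>I. fps_of_poly (N i) / fps_of_poly (D i))"
    and d: "d \<le> n"
  shows "coeff P (n - d) = fps_nth (\<Sum>i\<in>I. fps_of_poly (N' i) / fps_of_poly (D' i)) d"
proof -
  \<comment> \<open>Reversal with respect to \<open>n\<close> and not to the degree of
    \<open>P\<close>, which may be smaller.\<close>
  define P' where "P' = (\<Sum>d\<le>n. monom (coeff P (n - d)) d)"
  have "poly P' x = (\<Sum>i\<in>I. poly (N' i) x / poly (D' i) x)" if x: "1 < x" for x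
  proof -
    have "poly P' x = (\<Sum>d\<le>n. coeff P (n - d) * x ^ d)"
      by (simp add: P'_def poly_sum poly_monom)
    also have "\<dots> = (\<Sum>d\<le>n. coeff P d * x ^ (n - d))"
      by (rule sum.reindex_bij_witness[of _ "\<lambda>d. n - d" "\<lambda>d. n - d"]) auto
    also have "\<dots> = (\<Sum>d\<le>n. x ^ n * (coeff P d * (1 / x) ^ d))"
      using x by (intro sum.cong) (auto simp: power_diff power_one_over field_simps)
    also have "\<dots> = x ^ n * poly P (1 / x)"
    proof -
      have "poly P (1 / x) = (\<Sum>d\<le>n. coeff P d * (1 / x) ^ d)"
        unfolding poly_altdef by (rule sum.mono_neutral_left) (use deg in \<open>auto simp: coeff_eq_0\<close>)
      then show ?thesis by (simp only: sum_distrib_left)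
    qed
    also have "poly P (1 / x) = (\<Sum>i\<in>I. poly (N i) (1 / x) / poly (D i) (1 / x))"
      unfolding sum_fractions_eval_iff[OF I D(1)[OF x]]
      using P unfolding sum_fractions_iff[OF I D0(1)] by (rule arg_cong)
    also have "x ^ n * \<dots> = (\<Sum>i\<in>I. poly (N' i) x / poly (D' i) x)"
      unfolding sum_distrib_left by (intro sum.cong refl eq x)
    finally show ?thesis .
  qed
  note eval = this
  have *: "poly (P' * (\<Prod>i\<in>I. D' i)) x = poly (\<Sum>i\<in>I. N' i * (\<Prod>k\<in>I-{i}. D' k)) x" if "1 < x" for x
    unfolding sum_fractions_eval_iff[OF I D(2)[OF that], symmetric] by (rule eval[OF that])
  have "P' * (\<Prod>i\<in>I. D' i) - (\<Sum>i\<in>I. N' i * (\<Prod>k\<in>I-{i}. D' k)) = 0" (is "?p = 0")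
  proof (rule ccontr)
    assume "?p \<noteq> 0"
    then have "finite {x. poly ?p x = 0}" by (rule poly_roots_finite)
    moreover have "{1<..} \<subseteq> {x. poly ?p x = 0}"
      using * by (intro subsetI CollectI) (simp only: poly_diff greaterThan_iff right_minus_eq)
    ultimately show False using infinite_Ioi[of "1::rat"] finite_subset by blast
  qed
  then have "fps_of_poly P' = (\<Sum>i\<in>I. fps_of_poly (N' i) / fps_of_poly (D' i))"
    using sum_fractions_iff[OF I D0(2)] by simp
  moreover have "coeff P' d = coeff P (n - d)"
    using d by (simp add: P'_def coeff_sum)
  ultimately show ?thesis by (metis fps_of_poly_nth)
qed

text \<open>In each factor 1 - 1/y = -(1 - y)/y. The sign is kept as a power in the number of
  factors so that it can cancel between numerator and denominator.\<close>

lemma prod_one_minus_reciprocal: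
  fixes x :: "'a::field"
  assumes "x \<noteq> 0" "finite J"
  shows "(\<Prod>j\<in>J. 1 - (1 / x) ^ f j) = (- 1) ^ card J * (\<Prod>j\<in>J. 1 - x ^ f j) / x ^ (\<Sum>j\<in>J. f j)"
  using assms(2)
proof induction
  case (insert j J)
  have "1 - (1 / x) ^ f j = - (1 - x ^ f j) / x ^ f j"
    using assms(1) by (simp add: field_simps power_one_over)
  moreover have "(- a / b) * (s * p / c) = (- 1 * s) * (a * p) / (b * c)" for a b c s p :: 'a
    by simp
  ultimately show ?case
    by (simp only: prod.insert[OF insert.hyps] sum.insert[OF insert.hyps]
        card_insert_disjoint[OF insert.hyps] insert.IH power_add power_Suc)
qed simp

section \<open>Sums over the blocks of a weak composition\<close>

lemma sum_lessThan_add: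
  "(\<Sum>k<a + b. h k) = (\<Sum>k<a. h k) + (\<Sum>j<b. h (a + j :: nat))"
  for h :: "nat \<Rightarrow> 'a::comm_monoid_add"
  by (induction b) (simp_all add: add.assoc)

lemma psum_Suc: "i < length \<beta> \<Longrightarrow> psum \<beta> (Suc i) = psum \<beta> i + \<beta> ! i"
  by (simp add: psum_def take_Suc_conv_app_nth)

lemma psum_length: "psum \<beta> (length \<beta>) = sum_list \<beta>"
  by (simp add: psum_def)

lemma psum_le: "psum \<beta> i \<le> sum_list \<beta>"
  unfolding psum_def by (metis append_take_drop_id le_add1 sum_list_append)

text \<open>The indices \<open>psum \<beta> i + j\<close> run once through 0, ..., |\<beta>| - 1.
  Thus the powers of q subtracted in the denominator are those subtracted in the numerator of
  \<open>C_series\<close>.\<close>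

lemma sum_psum_blocks:
  fixes h :: "nat \<Rightarrow> 'a::comm_monoid_add"
  shows "(\<Sum>i<length \<beta>. \<Sum>j<\<beta> ! i. h (psum \<beta> i + j)) = (\<Sum>k<sum_list \<beta>. h k)"
proof -
  have "(\<Sum>i<l. \<Sum>j<\<beta> ! i. h (psum \<beta> i + j)) = (\<Sum>k<psum \<beta> l. h k)" if "l \<le> length \<beta>" for l
    using that
  proof (induction l)
    case 0
    then show ?case by (simp add: psum_def)
  next
    case (Suc l)
    then show ?case by (simp add: psum_Suc sum_lessThan_add)
  qed
  from this[of "length \<beta>"] show ?thesis by (simp add: psum_length)
qed

lemma finite_weak_compositions_below: "finite (weak_compositions_below \<alpha>)"
proof (rule finite_subset)
  show "weak_compositions_below \<alpha> \<subseteq> {\<beta>. set \<beta> \<subseteq> {..sum_list \<alpha>} \<and> length \<beta> = length \<alpha>}"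
  proof
    fix \<beta> assume \<beta>: "\<beta> \<in> weak_compositions_below \<alpha>"
    have "b \<le> sum_list \<alpha>" if b: "b \<in> set \<beta>" for b
    proof -
      obtain i where i: "i < length \<beta>" "\<beta> ! i = b" using b by (meson in_set_conv_nth)
      then have "i < length \<alpha>" "b \<le> \<alpha> ! i" using \<beta> by (auto simp: weak_compositions_below_def)
      then show ?thesis using elem_le_sum_list[of i \<alpha>] by simp
    qed
    then show "\<beta> \<in> {\<beta>. set \<beta> \<subseteq> {..sum_list \<alpha>} \<and> length \<beta> = length \<alpha>}"
      using \<beta> by (auto simp: weak_compositions_below_def)
  qed
  show "finite {\<beta>. set \<beta> \<subseteq> {..sum_list \<alpha>} \<and> length \<beta> = length \<alpha>}"
    by (rule finite_lists_length_eq) simp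
qed

lemma sum_list_weak_composition_le:
  "\<beta> \<in> weak_compositions_below \<alpha> \<Longrightarrow> sum_list \<beta> \<le> sum_list \<alpha>"
  by (auto simp: weak_compositions_below_def intro: sum_list_mono2)

lemma denominator_exponent_pos:
  assumes "1 < (q::nat)" "i < length \<beta>" "j < \<beta> ! i"
  shows "q ^ (psum \<beta> i + j) < q ^ psum \<beta> (Suc i)"
  using assms by (simp add: psum_Suc)

text \<open>Balance of the exponents under t -> 1/t, written with sums on both sides. The double sum
  and the last sum both lack the same sum of \<open>q ^ j\<close> over j < |\<beta>|, which
  therefore cancels; the rest is an identity for each single part.\<close>

lemma reflection_exponent:
  fixes q m :: nat
  assumes q: "1 < q" and \<beta>: "\<beta> \<in> weak_compositions_below \<alpha>" and m: "sum_list \<beta> \<le> m"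
  shows "sum_list \<alpha> * (q ^ m - 1) +
      (\<Sum>i<length \<beta>. \<Sum>j<\<beta> ! i. q ^ psum \<beta> (Suc i) - q ^ (psum \<beta> i + j)) =
    (\<Sum>i<length \<alpha>. \<alpha> ! i * (q ^ psum \<beta> (Suc i) - 1)) +
    ((\<Sum>i<length \<alpha>. (\<alpha> ! i - \<beta> ! i) * (q ^ m - q ^ psum \<beta> (Suc i))) +
     (\<Sum>j<sum_list \<beta>. q ^ m - q ^ j))"
proof -
  let ?Q = "\<lambda>i. q ^ psum \<beta> (Suc i)"
  let ?S = "\<Sum>j<sum_list \<beta>. q ^ j"
  have len: "length \<beta> = length \<alpha>" and le: "\<And>i. i < length \<alpha> \<Longrightarrow> \<beta> ! i \<le> \<alpha> ! i"
    using \<beta> by (auto simp: weak_compositions_below_def)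
  have 1: "(\<Sum>i<length \<beta>. \<Sum>j<\<beta> ! i. ?Q i - q ^ (psum \<beta> i + j)) + ?S = (\<Sum>i<length \<beta>. \<beta> ! i * ?Q i)"
    unfolding sum_psum_blocks[where \<beta> = \<beta> and h = "\<lambda>k. q ^ k", symmetric] sum.distrib[symmetric]
  proof (intro sum.cong refl)
    fix i assume i: "i \<in> {..<length \<beta>}"
    have "(\<Sum>j<\<beta> ! i. ?Q i - q ^ (psum \<beta> i + j) + q ^ (psum \<beta> i + j)) = (\<Sum>j<\<beta> ! i. ?Q i)"
    proof (intro sum.cong refl)
      fix j assume "j \<in> {..<\<beta> ! i}"
      then show "?Q i - q ^ (psum \<beta> i + j) + q ^ (psum \<beta> i + j) = ?Q i"
        using denominator_exponent_pos[OF q, of i \<beta> j] i by simp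
    qed
    then show "(\<Sum>j<\<beta> ! i. ?Q i - q ^ (psum \<beta> i + j) + q ^ (psum \<beta> i + j)) = \<beta> ! i * ?Q i"
      by simp
  qed
  have 2: "(\<Sum>j<sum_list \<beta>. q ^ m - q ^ j) + ?S = (\<Sum>i<length \<beta>. \<beta> ! i * q ^ m)"
  proof -
    have "(\<Sum>j<sum_list \<beta>. q ^ m - q ^ j) + ?S = (\<Sum>j<sum_list \<beta>. q ^ m)"
      unfolding sum.distrib[symmetric]
    proof (intro sum.cong refl)
      fix j assume "j \<in> {..<sum_list \<beta>}"
      then have "q ^ j \<le> q ^ m" using q m by (intro power_increasing) auto
      then show "q ^ m - q ^ j + q ^ j = q ^ m" by simp
    qed
    then show ?thesis by (simp add: sum_list_sum_nth atLeast0LessThan sum_distrib_right)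
  qed
  have 3: "\<alpha> ! i * (q ^ m - 1) + \<beta> ! i * ?Q i =
      \<alpha> ! i * (?Q i - 1) + (\<alpha> ! i - \<beta> ! i) * (q ^ m - ?Q i) + \<beta> ! i * q ^ m" if i: "i < length \<alpha>" for i
  proof -
    \<comment> \<open>Naming the differences \<open>c\<close>, \<open>u\<close> and \<open>v\<close>
      turns truncated subtractions into sums and leaves a semiring identity.\<close>
    obtain c where c: "\<alpha> ! i = \<beta> ! i + c" using le_Suc_ex[OF le[OF i]] by (elim exE)
    have "?Q i \<le> q ^ m" using q m psum_le[of \<beta> "Suc i"] by (intro power_increasing) auto
    from le_Suc_ex[OF this] obtain u where u: "q ^ m = ?Q i + u" by (elim exE)
    have "1 \<le> ?Q i" using q by simp
    from le_Suc_ex[OF this] obtain v where v: "?Q i = 1 + v" by (elim exE)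
    show ?thesis unfolding c u v by (simp add: algebra_simps)
  qed
  have "(\<Sum>i<length \<alpha>. \<alpha> ! i * (q ^ m - 1) + \<beta> ! i * ?Q i) =
    (\<Sum>i<length \<alpha>. \<alpha> ! i * (?Q i - 1) + (\<alpha> ! i - \<beta> ! i) * (q ^ m - ?Q i) + \<beta> ! i * q ^ m)"
    by (rule sum.cong[OF refl], rule 3) simp
  moreover have "sum_list \<alpha> * (q ^ m - 1) = (\<Sum>i<length \<alpha>. \<alpha> ! i * (q ^ m - 1))"
    by (simp add: sum_list_sum_nth atLeast0LessThan sum_distrib_right)
  ultimately show ?thesis
    using 1 2 unfolding sum.distrib len by linarith
qed

section \<open>Denominators and the reflection of \<open>C_series\<close>\<close>

definition denominator_poly :: "nat \<Rightarrow> nat list \<Rightarrow> rat poly" where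
  "denominator_poly q \<beta> =
     (\<Prod>i<length \<beta>. \<Prod>j<\<beta> ! i. 1 - monom 1 (q ^ psum \<beta> (Suc i) - q ^ (psum \<beta> i + j)))"

lemma fps_of_denominator_poly: "fps_of_poly (denominator_poly q \<beta>) = qt_denominator q \<beta>"
  by (simp add: denominator_poly_def qt_denominator_def fps_of_poly_prod fps_of_poly_diff fps_of_poly_monom')

lemma poly_denominator:
  "poly (denominator_poly q \<beta>) x =
    (\<Prod>i<length \<beta>. \<Prod>j<\<beta> ! i. 1 - x ^ (q ^ psum \<beta> (Suc i) - q ^ (psum \<beta> i + j)))"
  by (simp add: denominator_poly_def poly_prod poly_monom)

text \<open>All exponents are positive, so among nonnegative \<open>x\<close> a power equals 1 only
  at 1. The case x = 0 gives the constant coefficient; the others are the points x > 1 and 1/x of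
  the comparison.\<close>

lemma poly_denominator_neq_0:
  assumes q: "1 < q" and x: "0 \<le> x" "x \<noteq> 1"
  shows "poly (denominator_poly q \<beta>) x \<noteq> 0"
proof -
  have "1 - x ^ (q ^ psum \<beta> (Suc i) - q ^ (psum \<beta> i + j)) \<noteq> 0" if "i < length \<beta>" "j < \<beta> ! i" for i j
  proof -
    let ?a = "q ^ psum \<beta> (Suc i) - q ^ (psum \<beta> i + j)"
    have "0 < ?a" using denominator_exponent_pos[OF q that] by simp
    then have "x ^ ?a < 1 \<or> 1 < x ^ ?a"
      using x one_less_power[of x ?a] power_less_one_iff[of x ?a] by (metis antisym_conv3)
    then have "x ^ ?a \<noteq> 1" by auto
    then show ?thesis by simp
  qed
  then show ?thesis by (simp add: poly_denominator)
qed

text \<open>This replaces the passage to the limit: factors whose exponents exceed \<open>d\<close>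
  do not affect the coefficients up to \<open>d\<close>.\<close>

lemma fps_nth_prod_one_minus_mult:
  fixes g :: "'a::comm_ring_1 fps"
  assumes "\<And>j. j \<in> J \<Longrightarrow> d < f j" "k \<le> d"
  shows "fps_nth ((\<Prod>j\<in>J. 1 - fps_X ^ f j) * g) k = fps_nth g k"
  using assms(1)
proof (induction J rule: infinite_finite_induct)
  case (insert j J)
  have "fps_nth (fps_X ^ f j * ((\<Prod>j\<in>J. 1 - fps_X ^ f j) * g)) k = 0"
    using insert.prems[of j] assms(2) by (simp add: fps_X_power_mult_nth)
  then show ?case using insert by (simp add: left_diff_distrib mult.assoc)
qed simp_all

text \<open>For m at least the size of \<alpha> the condition |\<beta>| \<le> m excludes no \<beta>,
  so both series have the same index set and are matched summand by summand.\<close>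

lemma C_series_reflected:
  assumes q: "1 < q" and m: "sum_list \<alpha> \<le> m"
    and vanish: "\<forall>d > sum_list \<alpha> * (q ^ m - 1). fps_nth (C_series q \<alpha> m) d = 0"
    and d: "d \<le> sum_list \<alpha> * (q ^ m - 1)"
  shows "fps_nth (C_series q \<alpha> m) (sum_list \<alpha> * (q ^ m - 1) - d) =
    fps_nth (\<Sum>\<beta>\<in>weak_compositions_below \<alpha>.
      fps_X ^ (\<Sum>i<length \<alpha>. \<alpha> ! i * (q ^ psum \<beta> (Suc i) - 1)) *
      (\<Prod>j<sum_list \<beta>. 1 - fps_X ^ (q ^ m - q ^ j)) / qt_denominator q \<beta>) d"
proof -
  let ?n = "sum_list \<alpha> * (q ^ m - 1)"
  let ?B = "\<lambda>\<beta>. \<Prod>j<sum_list \<beta>. 1 - monom (1::rat) (q ^ m - q ^ j)"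
  define e1 where "e1 \<beta> = (\<Sum>i<length \<alpha>. (\<alpha> ! i - \<beta> ! i) * (q ^ m - q ^ psum \<beta> (Suc i)))" for \<beta>
  define e2 where "e2 \<beta> = (\<Sum>i<length \<alpha>. \<alpha> ! i * (q ^ psum \<beta> (Suc i) - 1))" for \<beta>
  define N where "N \<beta> = monom 1 (e1 \<beta>) * ?B \<beta>" for \<beta>
  define N' where "N' \<beta> = monom 1 (e2 \<beta>) * ?B \<beta>" for \<beta>
  \<comment> \<open>By \<open>vanish\<close> nothing is cut off: this polynomial is the whole
    series.\<close>
  define P where "P = (\<Sum>d\<le>?n. monom (fps_nth (C_series q \<alpha> m) d) d)"
  have coeff_P: "coeff P d = fps_nth (C_series q \<alpha> m) d" for d
    using vanish by (cases "d \<le> ?n") (simp_all add: P_def coeff_sum)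
  have I: "{\<beta> \<in> weak_compositions_below \<alpha>. sum_list \<beta> \<le> m} = weak_compositions_below \<alpha>"
    using sum_list_weak_composition_le m by fastforce
  have fpsB: "fps_of_poly (?B \<beta>) = (\<Prod>j<sum_list \<beta>. 1 - fps_X ^ (q ^ m - q ^ j))" for \<beta>
    by (simp add: fps_of_poly_prod fps_of_poly_diff fps_of_poly_monom')
  have coeff0: "coeff (denominator_poly q \<beta>) 0 \<noteq> 0" for \<beta>
    using poly_denominator_neq_0[OF q, of 0 \<beta>] by (simp add: poly_0_coeff_0)
  have unit: "fps_nth (qt_denominator q \<beta>) 0 \<noteq> 0" for \<beta>
    using coeff0 by (simp flip: fps_of_denominator_poly)
  have "coeff P (?n - d) = fps_nth (\<Sum>\<beta>\<in>weak_compositions_below \<alpha>.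
      fps_of_poly (N' \<beta>) / fps_of_poly (denominator_poly q \<beta>)) d"
  proof (rule reflected_sum_fractions[where N = N and D = "denominator_poly q"])
    show "finite (weak_compositions_below \<alpha>)" by (rule finite_weak_compositions_below)
    show "degree P \<le> ?n" unfolding P_def
      by (intro degree_sum_le) (auto intro: order.trans[OF degree_monom_le])
    show "d \<le> ?n" by (rule d)
    show "fps_of_poly P = (\<Sum>\<beta>\<in>weak_compositions_below \<alpha>.
      fps_of_poly (N \<beta>) / fps_of_poly (denominator_poly q \<beta>))"
    proof -
      have "fps_of_poly P = C_series q \<alpha> m" by (rule fps_ext) (simp add: coeff_P)
      also have "\<dots> = (\<Sum>\<beta>\<in>weak_compositions_below \<alpha>.
        fps_of_poly (N \<beta>) / fps_of_poly (denominator_poly q \<beta>))"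
        unfolding C_series_def I
        by (intro sum.cong refl)
          (simp add: N_def fps_of_poly_mult fpsB fps_of_poly_monom' fps_of_denominator_poly e1_def
            fps_divide_unit unit mult.assoc)
      finally show ?thesis .
    qed
    fix \<beta> and x :: rat assume \<beta>: "\<beta> \<in> weak_compositions_below \<alpha>" and x: "1 < x"
    show "x ^ ?n * (poly (N \<beta>) (1 / x) / poly (denominator_poly q \<beta>) (1 / x)) =
        poly (N' \<beta>) x / poly (denominator_poly q \<beta>) x"
    proof -
      let ?K = "SIGMA i:{..<length \<beta>}. {..<\<beta> ! i}"
      let ?a = "\<lambda>(i, j). q ^ psum \<beta> (Suc i) - q ^ (psum \<beta> i + j)"
      let ?b = "\<lambda>j. q ^ m - q ^ j"
      let ?S = "\<Sum>j<sum_list \<beta>. ?b j"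
      let ?A = "\<Sum>k\<in>?K. ?a k"
      \<comment> \<open>Numerator and denominator have equally many factors, hence pick up the same
        sign.\<close>
      let ?s = "(- 1) ^ sum_list \<beta> :: rat"
      have x0: "x \<noteq> 0" using x by simp
      have den: "poly (denominator_poly q \<beta>) y = (\<Prod>k\<in>?K. 1 - y ^ ?a k)" for y
        unfolding poly_denominator by (subst prod.Sigma) (auto intro!: prod.cong)
      have card: "card ?K = sum_list \<beta>"
        by (simp add: card_SigmaI sum_list_sum_nth atLeast0LessThan)
      have den_x: "poly (denominator_poly q \<beta>) (1 / x) = ?s * poly (denominator_poly q \<beta>) x / x ^ ?A"
        unfolding den using prod_one_minus_reciprocal[OF x0, of ?K ?a] card by simp
      have B: "poly (?B \<beta>) y = (\<Prod>j<sum_list \<beta>. 1 - y ^ ?b j)" for y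
        by (simp add: poly_prod poly_monom)
      have B_x: "poly (?B \<beta>) (1 / x) = ?s * poly (?B \<beta>) x / x ^ ?S"
        unfolding B using prod_one_minus_reciprocal[OF x0, of "{..<sum_list \<beta>}" ?b] by simp
      have A: "?A = (\<Sum>i<length \<beta>. \<Sum>j<\<beta> ! i. q ^ psum \<beta> (Suc i) - q ^ (psum \<beta> i + j))"
        by (subst sum.Sigma) (auto intro!: sum.cong)
      have "?n + ?A = e2 \<beta> + (e1 \<beta> + ?S)"
        unfolding A e1_def e2_def
        using reflection_exponent[OF q \<beta>] sum_list_weak_composition_le[OF \<beta>] m by simp
      then have pow: "x ^ ?n * x ^ ?A = x ^ e2 \<beta> * (x ^ e1 \<beta> * x ^ ?S)"
        by (simp flip: power_add)
      have nz: "poly (denominator_poly q \<beta>) x \<noteq> 0"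
        by (rule poly_denominator_neq_0[OF q]) (use x in auto)
      have "x ^ ?n * (poly (N \<beta>) (1 / x) / poly (denominator_poly q \<beta>) (1 / x)) =
          (x ^ ?n * x ^ ?A) * poly (?B \<beta>) x / (x ^ e1 \<beta> * x ^ ?S * poly (denominator_poly q \<beta>) x)"
        unfolding N_def poly_mult den_x B_x using x0 nz
        by (simp add: poly_monom power_one_over field_simps)
      also have "\<dots> = x ^ e2 \<beta> * poly (?B \<beta>) x / poly (denominator_poly q \<beta>) x"
        unfolding pow using x0 nz by (simp add: field_simps)
      finally show ?thesis unfolding N'_def poly_mult by (simp add: poly_monom)
    qed
  next
    fix x :: rat assume x: "1 < x"
    have "poly (denominator_poly q \<beta>) (1 / x) \<noteq> 0" for \<beta>
      by (rule poly_denominator_neq_0[OF q]) (use x in auto)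
    moreover have "poly (denominator_poly q \<beta>) x \<noteq> 0" for \<beta>
      by (rule poly_denominator_neq_0[OF q]) (use x in auto)
    ultimately show "\<forall>\<beta>\<in>weak_compositions_below \<alpha>. poly (denominator_poly q \<beta>) (1 / x) \<noteq> 0"
      "\<forall>\<beta>\<in>weak_compositions_below \<alpha>. poly (denominator_poly q \<beta>) x \<noteq> 0"
      by blast+
  qed (intro ballI coeff0)+
  then show ?thesis
    by (simp add: coeff_P N'_def fps_of_poly_mult fpsB fps_of_poly_monom' fps_of_denominator_poly e2_def)
qed

lemma cofixed_series_altdef:
  assumes q: "1 < q"
  shows "cofixed_series q \<alpha> = (\<Sum>\<beta>\<in>weak_compositions_below \<alpha>.
    fps_X ^ (\<Sum>i<length \<alpha>. \<alpha> ! i * (q ^ psum \<beta> (Suc i) - 1)) * inverse (qt_denominator q \<beta>))"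
  unfolding cofixed_series_def
proof (intro sum.cong refl arg_cong2[where f = "(*)"])
  fix \<beta> assume "\<beta> \<in> weak_compositions_below \<alpha>"
  then have len: "length \<beta> = length \<alpha>" by (simp add: weak_compositions_below_def)
  have prod_inverse: "(\<Prod>i\<in>A. inverse (f i)) = inverse (\<Prod>i\<in>A. f i)" for A and f :: "nat \<Rightarrow> rat fps"
    by (induction A rule: infinite_finite_induct) (simp_all add: fps_inverse_mult)
  have "1 / (1 - fps_X ^ (q ^ psum \<beta> (Suc i) - q ^ (psum \<beta> i + j))) =
      (inverse (1 - fps_X ^ (q ^ psum \<beta> (Suc i) - q ^ (psum \<beta> i + j))) :: rat fps)"
    if "i < length \<beta>" "j < \<beta> ! i" for i j
    by (subst fps_divide_unit) (use denominator_exponent_pos[OF q that] in auto)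
  then have "(\<Prod>i<length \<alpha>. \<Prod>j<\<beta> ! i. 1 / (1 - fps_X ^ (q ^ psum \<beta> (Suc i) - q ^ (psum \<beta> i + j)))) =
      (\<Prod>i<length \<beta>. \<Prod>j<\<beta> ! i.
        (inverse (1 - fps_X ^ (q ^ psum \<beta> (Suc i) - q ^ (psum \<beta> i + j))) :: rat fps))"
    unfolding len by (intro prod.cong refl) simp
  also have "\<dots> = inverse (qt_denominator q \<beta>)"
    unfolding qt_denominator_def by (simp only: prod_inverse)
  finally show "(\<Prod>i<length \<alpha>. \<Prod>j<\<beta> ! i. 1 / (1 - fps_X ^ (q ^ psum \<beta> (Suc i) - q ^ (psum \<beta> i + j)))) =
      (inverse (qt_denominator q \<beta>) :: rat fps)" .
qed

lemma C_series_reflected_nth: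
  assumes q: "1 < q" and m: "sum_list \<alpha> \<le> m" and large: "\<And>j. j < sum_list \<alpha> \<Longrightarrow> d < q ^ m - q ^ j"
    and vanish: "\<forall>d > sum_list \<alpha> * (q ^ m - 1). fps_nth (C_series q \<alpha> m) d = 0"
    and d: "d \<le> sum_list \<alpha> * (q ^ m - 1)"
  shows "fps_nth (C_series q \<alpha> m) (sum_list \<alpha> * (q ^ m - 1) - d) = fps_nth (cofixed_series q \<alpha>) d"
proof -
  have unit: "fps_nth (qt_denominator q \<beta>) 0 \<noteq> 0" for \<beta>
    using poly_denominator_neq_0[OF q, of 0 \<beta>] by (simp add: poly_0_coeff_0 flip: fps_of_denominator_poly)
  have "fps_nth (fps_X ^ e * (\<Prod>j<sum_list \<beta>. 1 - fps_X ^ (q ^ m - q ^ j)) / qt_denominator q \<beta>) d =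
      fps_nth (fps_X ^ e * inverse (qt_denominator q \<beta>)) d"
    if "\<beta> \<in> weak_compositions_below \<alpha>" for \<beta> e
  proof -
    have "d < q ^ m - q ^ j" if "j \<in> {..<sum_list \<beta>}" for j
      using that sum_list_weak_composition_le[OF \<open>\<beta> \<in> _\<close>] by (intro large) simp
    then show ?thesis
      using fps_nth_prod_one_minus_mult[of "{..<sum_list \<beta>}" d "\<lambda>j. q ^ m - q ^ j" d
          "fps_X ^ e * inverse (qt_denominator q \<beta>)"]
      by (simp add: fps_divide_unit[OF unit] mult_ac)
  qed
  note eq = this
  show ?thesis
    unfolding C_series_reflected[OF q m vanish d] cofixed_series_altdef[OF q] fps_sum_nth
    by (intro sum.cong refl eq)
qed

section \<open>Cofixed spaces of parabolic subgroups\<close>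

theorem corollary3p5:
  fixes \<alpha> :: "nat list"
  assumes "\<And>\<alpha> m. composition \<alpha> CARD('n) \<Longrightarrow>
      hilbert_series (frobenius_power (CARD('k) ^ m))
        (fixed_space (parabolic \<alpha> :: ('k::{field, finite} ^ 'n::{finite, linorder} ^ 'n::{finite, linorder}) set)
           (frobenius_power (CARD('k) ^ m)))
      = C_series CARD('k) \<alpha> m"
    and "composition \<alpha> CARD('n)"
  shows "hilbert_series (cofixed_kernel (parabolic \<alpha> :: ('k::{field, finite} ^ 'n::{finite, linorder} ^ 'n::{finite, linorder}) set))
           (quotient_space (cofixed_kernel (parabolic \<alpha> :: ('k::{field, finite} ^ 'n::{finite, linorder} ^ 'n::{finite, linorder}) set)))
         = cofixed_series CARD('k) \<alpha>"
proof (rule fps_ext)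
  fix d
  let ?q = "CARD('k)" and ?n = "CARD('n)"
  let ?G = "parabolic \<alpha> :: ('k::{field, finite} ^ 'n::{finite, linorder} ^ 'n::{finite, linorder}) set"
  \<comment> \<open>q^(n+d) exceeds d and is at least q^j for j < n. One further factor q \<ge> 2
    gives q^m - q^j \<ge> q^(n+d) > d, and m \<ge> n holds as well.\<close>
  define m where "m = Suc (?n + d)"
  have q: "2 \<le> ?q"
    using card_mono[of "UNIV :: 'k set" "{0, 1}"] by simp
  have sum: "sum_list \<alpha> = ?n" using assms(2) by (simp add: composition_def)
  have G: "\<forall>g\<in>?G. invertible g" by (simp add: parabolic_def)
  have large: "d < ?q ^ m - ?q ^ j" if "j < ?n" for j
  proof -
    have "d < 2 ^ (?n + d)" by (rule less_le_trans[OF less_exp]) (simp add: power_increasing)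
    also have "\<dots> \<le> ?q ^ (?n + d)" using q by (rule power_mono) simp
    finally have "d < ?q ^ (?n + d)" .
    moreover have "?q ^ j \<le> ?q ^ (?n + d)" using q that by (intro power_increasing) auto
    moreover have "2 * ?q ^ (?n + d) \<le> ?q ^ m" using q by (simp add: m_def)
    ultimately show ?thesis by linarith
  qed
  \<comment> \<open>The case j = 0 puts d into the range where duality applies.\<close>
  have "d < ?q ^ m - ?q ^ 0" by (rule large) simp
  then have d: "d \<le> ?q ^ m - 1" by simp
  have "1 * (?q ^ m - 1) \<le> ?n * (?q ^ m - 1)"
    by (intro mult_right_mono) (simp_all add: Suc_le_eq)
  then have dn: "d \<le> ?n * (?q ^ m - 1)" using d by linarith
  have hyp: "hilbert_series (frobenius_power (?q ^ m)) (fixed_space ?G (frobenius_power (?q ^ m)))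
      = C_series ?q \<alpha> m"
    by (rule assms(1)[OF assms(2)])
  \<comment> \<open>The vanishing of the quotient above the socle degree, read through the
    hypothesis, bounds the degree of \<open>C_series\<close>.\<close>
  have "\<forall>e > ?n * (?q ^ m - 1). fps_nth (C_series ?q \<alpha> m) e = 0"
    unfolding hyp[symmetric] using hilbert_series_fixed_nth_eq_0[OF refl G] by blast
  then have "fps_nth (C_series ?q \<alpha> m) (?n * (?q ^ m - 1) - d) = fps_nth (cofixed_series ?q \<alpha>) d"
    using C_series_reflected_nth[of ?q \<alpha> m d] q large dn by (simp add: sum m_def)
  then show "fps_nth (hilbert_series (cofixed_kernel ?G) (quotient_space (cofixed_kernel ?G))) d
      = fps_nth (cofixed_series ?q \<alpha>) d"
    unfolding hyp[symmetric] hilbert_series_fixed_nth[OF refl G d] .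
qed

end
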